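(* Let $\mathbb{F}$ be a field. There is an algorithm that, given any noncommutative arithmetic circuit $C$ computing a polynomial $f\in\mathbb{F}\{x_1,\ldots,x_n\}$ of degree at most $d$ and with at most $t$ monomials, computes all the monomials of $f$ together with their coefficients in time $\mathrm{poly}(|C|,d,n,t)$. In particular, if $C$ computes a sparse polynomial of polynomial degree, then $f$ can be reconstructed in polynomial time.
   Context: $\mathbb{F}\{x_1,\ldots,x_n\}$ is the ring of polynomials in noncommuting variables over $\mathbb{F}$. A noncommutative arithmetic circuit takes as inputs the variables $x_i$ and scalars from $\mathbb{F}$, and has addition gates and order-respecting multiplication gates; $|C|$ denotes its size. *)

theory Defs
  imports Main "HOL-Library.Poly_Mapping"
begin

section \<open>Noncommutative polynomials\<close>

text \<open>
  The ring of noncommutative polynomials is the monoid algebra of the free monoid of words.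
  Its multiplication is the convolution product that \<^theory>\<open>HOL-Library.Poly_Mapping\<close> provides
  over any additively written monoid, so concatenation of words is written \<open>+\<close>.
  The variables are \<open>x\<^sub>0, x\<^sub>1, \<dots>\<close>; the \<open>n\<close>-variable ring consists of the polynomials whose
  words only use letters below \<open>n\<close>.
\<close>

datatype word = Word (letters: "nat list")

instantiation word :: monoid_add
begin

definition zero_word :: word where
  "zero_word = Word []"

definition plus_word :: "word \<Rightarrow> word \<Rightarrow> word" where
  "plus_word u v = Word (letters u @ letters v)"

instance
  by standard (simp_all add: zero_word_def plus_word_def)

end

type_synonym 'a ncpoly = "word \<Rightarrow>\<^sub>0 'a"

definition nc_var :: "nat \<Rightarrow> 'a::field ncpoly" where
  "nc_var i = Poly_Mapping.single (Word [i]) 1"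

definition nc_const :: "'a::field \<Rightarrow> 'a ncpoly" where
  "nc_const c = Poly_Mapping.single 0 c"

abbreviation nc_coeff :: "'a::field ncpoly \<Rightarrow> word \<Rightarrow> 'a" where
  "nc_coeff \<equiv> Poly_Mapping.lookup"

abbreviation nc_monomials :: "'a::field ncpoly \<Rightarrow> word set" where
  "nc_monomials \<equiv> Poly_Mapping.keys"

text \<open>The zero polynomial gets degree 0.\<close>

definition nc_degree :: "'a::field ncpoly \<Rightarrow> nat" where
  "nc_degree f = Max (insert 0 ((\<lambda>w. length (letters w)) ` nc_monomials f))"


section \<open>Noncommutative arithmetic circuits\<close>

text \<open>
  A circuit is a directed acyclic graph given by its gates in topological order together with a
  designated output gate. The operands of an internal gate are positions of earlier gates.
  The first operand of a multiplication gate is its left factor.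
\<close>

datatype 'a gate =
    Input nat
  | Const 'a
  | Plus nat nat
  | Times nat nat

datatype 'a circuit = Circuit (gates: "'a gate list") (out: nat)

fun wf_gate :: "nat \<Rightarrow> nat \<Rightarrow> 'a gate \<Rightarrow> bool" where
  "wf_gate n p (Input i) \<longleftrightarrow> i < n"
| "wf_gate n p (Const c) \<longleftrightarrow> True"
| "wf_gate n p (Plus j k) \<longleftrightarrow> j < p \<and> k < p"
| "wf_gate n p (Times j k) \<longleftrightarrow> j < p \<and> k < p"

definition wf_circuit :: "nat \<Rightarrow> 'a circuit \<Rightarrow> bool" where
  "wf_circuit n C \<longleftrightarrow>
     (\<forall>p < length (gates C). wf_gate n p (gates C ! p)) \<and> out C < length (gates C)"

definition circuit_size :: "'a circuit \<Rightarrow> nat" where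
  "circuit_size C = length (gates C)"

fun gate_poly :: "'a::field ncpoly list \<Rightarrow> 'a gate \<Rightarrow> 'a ncpoly" where
  "gate_poly fs (Input i) = nc_var i"
| "gate_poly fs (Const c) = nc_const c"
| "gate_poly fs (Plus j k) = fs ! j + fs ! k"
| "gate_poly fs (Times j k) = fs ! j * fs ! k"

definition gate_polys :: "'a::field gate list \<Rightarrow> 'a ncpoly list" where
  "gate_polys gs = foldl (\<lambda>fs g. fs @ [gate_poly fs g]) [] gs"

definition circuit_poly :: "'a::field circuit \<Rightarrow> 'a ncpoly" where
  "circuit_poly C = gate_polys (gates C) ! out C"


section \<open>Algorithms over a field and their running time\<close>

text \<open>
  Algorithms are programs of a first-order, call-by-value functional language over binary trees
  whose leaves are either empty or hold one field element. As usual for algebraic algorithms over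
  an arbitrary field, a field operation or a test for zero costs one time unit. Every other step
  also costs one unit and is a constant-time pointer operation: values are immutable and hence
  shared, there is no comparison of trees, and natural numbers are not primitive.
  The only field constants in programs are 0 and 1, so programs are finite objects that do not
  depend on the field and cannot contain field elements as advice.
\<close>

datatype 'a val =
    Empty
  | Scalar 'a
  | Pair "'a val" "'a val"

text \<open>
  Variables are de Bruijn indices into the environment. \<open>LetE\<close> pushes a value onto the
  environment; the body of a called function sees exactly the list of its arguments.
\<close>

datatype expr =
    Var nat
  | EmptyE
  | PairE expr expr
  | FstE expr
  | SndE expr
  | IfEmpty expr expr expr
  | ZeroE
  | OneE
  | AddE expr expr
  | SubE expr expr
  | MulE expr expr
  | DivE expr expr
  | IfZero expr expr expr
  | LetE expr expr
  | CallE nat "expr list"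

type_synonym prog = "expr list"

text \<open>
  \<open>eval P env e v T\<close>: in program \<open>P\<close>, expression \<open>e\<close> evaluates to \<open>v\<close> in exactly \<open>T\<close> steps.
  An ill-typed operation or a division by zero has no evaluation.
\<close>

inductive eval :: "prog \<Rightarrow> 'a::field val list \<Rightarrow> expr \<Rightarrow> 'a val \<Rightarrow> nat \<Rightarrow> bool"
  and evals :: "prog \<Rightarrow> 'a::field val list \<Rightarrow> expr list \<Rightarrow> 'a val list \<Rightarrow> nat \<Rightarrow> bool"
  for P :: prog
where
  Var: "i < length env \<Longrightarrow> eval P env (Var i) (env ! i) 1"
| Empty: "eval P env EmptyE Empty 1"
| Pair: "eval P env a u S \<Longrightarrow> eval P env b v T \<Longrightarrow>
    eval P env (PairE a b) (Pair u v) (S + T + 1)"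
| Fst: "eval P env a (Pair u v) T \<Longrightarrow> eval P env (FstE a) u (T + 1)"
| Snd: "eval P env a (Pair u v) T \<Longrightarrow> eval P env (SndE a) v (T + 1)"
| IfEmpty_True: "eval P env c Empty S \<Longrightarrow> eval P env a v T \<Longrightarrow>
    eval P env (IfEmpty c a b) v (S + T + 1)"
| IfEmpty_False: "eval P env c u S \<Longrightarrow> u \<noteq> Empty \<Longrightarrow> eval P env b v T \<Longrightarrow>
    eval P env (IfEmpty c a b) v (S + T + 1)"
| Zero: "eval P env ZeroE (Scalar 0) 1"
| One: "eval P env OneE (Scalar 1) 1"
| Add: "eval P env a (Scalar x) S \<Longrightarrow> eval P env b (Scalar y) T \<Longrightarrow>
    eval P env (AddE a b) (Scalar (x + y)) (S + T + 1)"
| Sub: "eval P env a (Scalar x) S \<Longrightarrow> eval P env b (Scalar y) T \<Longrightarrow>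
    eval P env (SubE a b) (Scalar (x - y)) (S + T + 1)"
| Mul: "eval P env a (Scalar x) S \<Longrightarrow> eval P env b (Scalar y) T \<Longrightarrow>
    eval P env (MulE a b) (Scalar (x * y)) (S + T + 1)"
| Div: "eval P env a (Scalar x) S \<Longrightarrow> eval P env b (Scalar y) T \<Longrightarrow> y \<noteq> 0 \<Longrightarrow>
    eval P env (DivE a b) (Scalar (x / y)) (S + T + 1)"
| IfZero_True: "eval P env c (Scalar 0) S \<Longrightarrow> eval P env a v T \<Longrightarrow>
    eval P env (IfZero c a b) v (S + T + 1)"
| IfZero_False: "eval P env c (Scalar x) S \<Longrightarrow> x \<noteq> 0 \<Longrightarrow> eval P env b v T \<Longrightarrow>
    eval P env (IfZero c a b) v (S + T + 1)"
| Let: "eval P env a u S \<Longrightarrow> eval P (u # env) b v T \<Longrightarrow>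
    eval P env (LetE a b) v (S + T + 1)"
| Call: "evals P env as us S \<Longrightarrow> f < length P \<Longrightarrow> eval P us (P ! f) v T \<Longrightarrow>
    eval P env (CallE f as) v (S + T + 1)"
| Args_Nil: "evals P env [] [] 0"
| Args_Cons: "eval P env a u S \<Longrightarrow> evals P env as us T \<Longrightarrow>
    evals P env (a # as) (u # us) (S + T)"

lemma eval_deterministic:
  "eval P env e v T \<Longrightarrow> (\<And>v' T'. eval P env e v' T' \<Longrightarrow> v' = v \<and> T' = T)"
  "evals P env es vs T \<Longrightarrow> (\<And>vs' T'. evals P env es vs' T' \<Longrightarrow> vs' = vs \<and> T' = T)"
proof (induction rule: eval_evals.inducts)
  case (Var i env)
  then show ?case
    by (auto elim: eval.cases)
next
  case (Empty env)
  then show ?case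
    by (auto elim: eval.cases)
next
  case (Pair env a u S b v T)
  from Pair.prems show ?case
    by (cases rule: eval.cases) (auto dest!: Pair.IH(2) Pair.IH(4))
next
  case (Fst env a u v T)
  from Fst.prems show ?case
    by (cases rule: eval.cases) (auto dest!: Fst.IH(2))
next
  case (Snd env a u v T)
  from Snd.prems show ?case
    by (cases rule: eval.cases) (auto dest!: Snd.IH(2))
next
  case (IfEmpty_True env c S a v T b)
  from IfEmpty_True.prems show ?case
    by (cases rule: eval.cases) (auto dest!: IfEmpty_True.IH(2) IfEmpty_True.IH(4))
next
  case (IfEmpty_False env c u S b v T a)
  from IfEmpty_False.prems IfEmpty_False.hyps show ?case
    by (cases rule: eval.cases) (auto dest!: IfEmpty_False.IH(2) IfEmpty_False.IH(4))
next
  case (Zero env)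
  then show ?case
    by (auto elim: eval.cases)
next
  case (One env)
  then show ?case
    by (auto elim: eval.cases)
next
  case (Add env a x S b y T)
  from Add.prems show ?case
    by (cases rule: eval.cases) (auto dest!: Add.IH(2) Add.IH(4))
next
  case (Sub env a x S b y T)
  from Sub.prems show ?case
    by (cases rule: eval.cases) (auto dest!: Sub.IH(2) Sub.IH(4))
next
  case (Mul env a x S b y T)
  from Mul.prems show ?case
    by (cases rule: eval.cases) (auto dest!: Mul.IH(2) Mul.IH(4))
next
  case (Div env a x S b y T)
  from Div.prems show ?case
    by (cases rule: eval.cases) (auto dest!: Div.IH(2) Div.IH(4))
next
  case (IfZero_True env c S a v T b)
  from IfZero_True.prems show ?case
    by (cases rule: eval.cases) (auto dest!: IfZero_True.IH(2) IfZero_True.IH(4))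
next
  case (IfZero_False env c x S b v T a)
  from IfZero_False.prems IfZero_False.hyps show ?case
    by (cases rule: eval.cases) (auto dest!: IfZero_False.IH(2) IfZero_False.IH(4))
next
  case (Let env a u S b v T)
  from Let.prems show ?case
    by (cases rule: eval.cases) (auto dest!: Let.IH(2) Let.IH(4))
next
  case (Call env as us S f v T)
  from Call.prems show ?case
    by (cases rule: eval.cases) (auto dest!: Call.IH(2) Call.IH(5))
next
  case (Args_Nil env)
  then show ?case
    by (auto elim: evals.cases)
next
  case (Args_Cons env a u S as us T)
  from Args_Cons.prems show ?case
    by (cases rule: evals.cases) (auto dest!: Args_Cons.IH(2) Args_Cons.IH(4))
qed

text \<open>Function 0 is the entry point of a program.\<close>

definition runs :: "prog \<Rightarrow> 'a::field val list \<Rightarrow> 'a val \<Rightarrow> nat \<Rightarrow> bool" where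
  "runs P args v T \<longleftrightarrow> P \<noteq> [] \<and> eval P args (P ! 0) v T"


section \<open>Encoding of inputs and outputs\<close>

text \<open>
  Numbers are encoded in unary. Variable indices, positions of gates and the parameters are
  bounded by the quantities in which the running time is measured, so this changes the length of
  the input by at most a polynomial factor.
\<close>

fun enc_nat :: "nat \<Rightarrow> 'a val" where
  "enc_nat 0 = Empty"
| "enc_nat (Suc k) = Pair Empty (enc_nat k)"

fun enc_list :: "'a val list \<Rightarrow> 'a val" where
  "enc_list [] = Empty"
| "enc_list (v # vs) = Pair v (enc_list vs)"

fun enc_gate :: "'a gate \<Rightarrow> 'a val" where
  "enc_gate (Input i) = Pair (enc_nat 0) (enc_nat i)"
| "enc_gate (Const c) = Pair (enc_nat 1) (Scalar c)"
| "enc_gate (Plus j k) = Pair (enc_nat 2) (Pair (enc_nat j) (enc_nat k))"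
| "enc_gate (Times j k) = Pair (enc_nat 3) (Pair (enc_nat j) (enc_nat k))"

definition enc_circuit :: "'a circuit \<Rightarrow> 'a val" where
  "enc_circuit C = Pair (enc_list (map enc_gate (gates C))) (enc_nat (out C))"

definition enc_term :: "word \<times> 'a \<Rightarrow> 'a val" where
  "enc_term m = Pair (enc_list (map enc_nat (letters (fst m)))) (Scalar (snd m))"

text \<open>
  The output is an explicit list, in any order but without repetitions, of exactly the monomials
  with nonzero coefficient, each paired with its coefficient.
\<close>

definition is_expansion :: "'a::field ncpoly \<Rightarrow> (word \<times> 'a) list \<Rightarrow> bool" where
  "is_expansion f ms \<longleftrightarrow>
     distinct ms \<and> set ms = (\<lambda>w. (w, nc_coeff f w)) ` nc_monomials f"

definition reconstructs_within :: "prog \<Rightarrow> 'a::field val list \<Rightarrow> 'a ncpoly \<Rightarrow> nat \<Rightarrow> bool" where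
  "reconstructs_within P args f B \<longleftrightarrow>
     (\<exists>ms T. is_expansion f ms \<and> runs P args (enc_list (map enc_term ms)) T \<and> T \<le> B)"

end

theory Submission
  imports Defs Complex_Main
begin

text \<open>
  Let \<open>M\<^sub>x\<close> be the 0-1 transition matrices of a deterministic automaton. Evaluating the circuit at
  these matrices, gate by gate, gives for every pair of states \<open>i, j\<close> the sum of the coefficients of
  all words that lead from \<open>i\<close> to \<open>j\<close>, whatever the degrees of the intermediate gates are. We use the
  automaton that reads a fixed prefix \<open>u\<close> and then tracks the residue modulo \<open>m\<close> of the remaining word,
  read as a number. Two distinct words have distinct numbers, and the product of the differences between
  one of the at most \<open>t\<close> words and all others has polynomially many bits, so it is not divisible by some
  \<open>m\<close> of polynomial size. For that \<open>m\<close> the residue class of the chosen word contains no other monomial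
  and its coefficient sum is nonzero. So trying all small \<open>m\<close> decides whether \<open>u\<close> is a prefix of some
  monomial. There are at most \<open>t\<close> such prefixes of each length, and extending them letter by letter
  finds all monomials. With \<open>m = 1\<close> the matrices give the coefficient sum of all words with prefix \<open>u\<close>;
  subtracting the sums of the one-letter extensions of \<open>u\<close> leaves the coefficient of \<open>u\<close>.
\<close>

text \<open>The obstacle is cancellation. Intermediate gates may have exponential degree and
  exponentially many monomials, so they cannot be expanded; matrices of fixed size retain just what
  is needed of them. Sums over a residue class can cancel too, but a class with a single monomial
  cannot: its sum is one nonzero coefficient, over every field.

  The bound on the modulus comes from counting bits. A word of length at most d has a value below
  (n+1)^d \<le> 2^(nd), so the product of at most t differences stays below 2^k for k =
  (t+1)(n+1)(d+1), whereas a nonzero common multiple of 1, ..., 2k is at least 2^k in absolute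
  value.

  The program uses t only in this k, and d only in k and as the depth of the search, so upper bounds
  for the two suffice. In the second half of the theorem they are not part of the input, and the
  program computes a common bound from the circuit size and n.\<close>

section \<open>Small non-divisors\<close>

text \<open>The entries \<open>1 / (k * (q choose k))\<close> of the Leibniz harmonic triangle are integer combinations of
  \<open>1, 1/2, \<dots>, 1/q\<close>: each is the difference of its two upper neighbours. Hence \<open>k * (q choose k)\<close>
  divides every common multiple of \<open>1, \<dots>, q\<close>.\<close>

lemma leibniz_triangle_dvd:
  fixes N :: int
  assumes "\<forall>i\<in>{1..q}. int i dvd N" "1 \<le> k" "k \<le> q"
  shows "int (k * (q choose k)) dvd N"
  using assms(2,1,3)
proof (induction k arbitrary: q rule: nat_induct_at_least)
  case base
  then show ?case by simp
next
  case (Suc k)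
  then obtain p where q: "q = Suc p" by (cases q) auto
  have "int (k * (p choose k)) dvd N" "int (k * (q choose k)) dvd N"
    using Suc.prems Suc.IH[of p] Suc.IH[of q] unfolding q by auto
  then obtain a b where a: "N = int (k * (p choose k)) * a" and b: "N = int (k * (q choose k)) * b"
    unfolding dvd_def by blast
  have kp: "k \<le> p" using Suc q by simp
  have s: "Suc k * (q choose Suc k) = q * (p choose k)"
    unfolding q by (simp only: Suc_times_binomial)
  have t: "(q - k) * (q choose k) = q * (p choose k)"
    using binomial_absorb_comp[of q k] q by simp
  define c where "c = int (p choose k)"
  define Q where "Q = int (q choose k)"
  have c0: "c \<noteq> 0" using kp by (simp add: c_def)
  have tt: "(int q - int k) * Q = int q * c"
    using arg_cong[OF t, of int] kp q unfolding c_def Q_def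
    by (simp only: of_nat_mult of_nat_diff le_SucI)
  have ka: "N = int k * c * a" "N = int k * Q * b" using a b unfolding c_def Q_def by auto
  have k0: "int k \<noteq> 0" using Suc by simp
  have ca: "c * a = Q * b" using ka k0 by auto
  have "N * (int q - int k) = int k * b * (int q * c)"
    using ka(2) tt by (metis (no_types, lifting) mult.assoc mult.commute)
  then have "int k * (c * (a * (int q - int k))) = int k * (c * (b * int q))"
    using ka(1) by (simp add: algebra_simps)
  then have e: "a * (int q - int k) = b * int q" using k0 c0 by simp
  \<comment> \<open>\<open>a\<close> and \<open>b\<close> are N times two neighbouring entries of
    the triangle, and \<open>a - b\<close> is N times the entry for \<open>Suc k\<close> and
    \<open>q\<close>.\<close>
  have "N = int q * c * (a - b)"
    using ka(1) e by (simp add: algebra_simps)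
  then have "int (q * (p choose k)) dvd N" unfolding c_def by simp
  then show ?case unfolding s .
qed

text \<open>Otherwise k times the central binomial coefficient (2k choose k) would divide N, and
  that is at least 2^k.\<close>

lemma ex_small_nondivisor:
  fixes N :: int
  assumes "N \<noteq> 0" "\<bar>N\<bar> < 2 ^ k"
  shows "\<exists>m\<in>{1..2 * k}. \<not> int m dvd N"
proof (rule ccontr)
  assume "\<not> ?thesis"
  then have all: "\<forall>i\<in>{1..2 * k}. int i dvd N" by auto
  have k: "1 \<le> k" using assms by (cases k) auto
  have "int (k * ((2 * k) choose k)) dvd N"
    by (rule leibniz_triangle_dvd[OF all]) (use k in auto)
  then have le: "int (k * ((2 * k) choose k)) \<le> \<bar>N\<bar>"
    using dvd_imp_le_int[OF assms(1)] by fastforce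
  have "2 ^ k \<le> ((2 * k) choose k)"
  proof -
    have "real (2 * k div k) ^ k \<le> real ((2 * k) choose k)" 
      using binomial_ge_n_over_k_pow_k[of k "2 * k", where ?'a = real] k by simp
    moreover have "2 * k div k = 2" using k by simp
    ultimately have "real (2 ^ k) \<le> real ((2 * k) choose k)" by simp
    then show ?thesis unfolding of_nat_le_iff .
  qed
  also have "\<dots> \<le> k * ((2 * k) choose k)" using k by simp
  finally have "int (2 ^ k) \<le> \<bar>N\<bar>" using le by (smt (verit) of_nat_le_iff)
  then show False using assms(2) by simp
qed

section \<open>Polynomials evaluated at the transition matrices of an automaton\<close>

text \<open>Transitions are partial: a word that leaves the prescribed prefix has no run and drops
  out of all sums.\<close>

fun run :: "(nat \<Rightarrow> nat \<Rightarrow> nat option) \<Rightarrow> nat \<Rightarrow> nat list \<Rightarrow> nat option" where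
  "run \<delta> i [] = Some i"
| "run \<delta> i (x # w) = (case \<delta> i x of None \<Rightarrow> None | Some j \<Rightarrow> run \<delta> j w)"

lemma run_append:
  "run \<delta> i (v @ w) = (case run \<delta> i v of None \<Rightarrow> None | Some k \<Rightarrow> run \<delta> k w)"
  by (induction v arbitrary: i) (auto split: option.splits)

lemma run_bounded:
  assumes "\<And>i x j. i < K \<Longrightarrow> \<delta> i x = Some j \<Longrightarrow> j < K"
  shows "i < K \<Longrightarrow> run \<delta> i w = Some j \<Longrightarrow> j < K"
  by (induction w arbitrary: i) (auto split: option.splits dest: assms)

text \<open>This is entry (i, j) of f at the transition matrices. The form as a sum over words shows
  which coefficients it collects; \<open>path_sum_add\<close> and \<open>path_sum_mult\<close>
  justify computing it gate by gate.\<close>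

definition path_sum :: "(nat \<Rightarrow> nat \<Rightarrow> nat option) \<Rightarrow> 'a::field ncpoly \<Rightarrow> nat \<Rightarrow> nat \<Rightarrow> 'a" where
  "path_sum \<delta> f i j =
     (\<Sum>w\<in>nc_monomials f. if run \<delta> i (letters w) = Some j then nc_coeff f w else 0)"

lemma path_sum_0 [simp]: "path_sum \<delta> 0 i j = 0"
  by (simp add: path_sum_def)

lemma path_sum_add: "path_sum \<delta> (f + g) i j = path_sum \<delta> f i j + path_sum \<delta> g i j"
  unfolding path_sum_def by (rule setsum_keys_plus_distrib) auto

lemma path_sum_single:
  "path_sum \<delta> (Poly_Mapping.single w c) i j = (if run \<delta> i (letters w) = Some j then c else 0)"
  by (simp add: path_sum_def)

lemma poly_mapping_single_induct [case_names zero add]: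
  fixes f :: "'b \<Rightarrow>\<^sub>0 'c::ab_group_add"
  assumes "P 0" "\<And>w c f. P f \<Longrightarrow> P (Poly_Mapping.single w c + f)"
  shows "P f"
proof (induction f rule: Poly_Mapping.update_induct)
  case const
  show ?case by (rule assms)
next
  case (update f a b)
  have "Poly_Mapping.update a b f = Poly_Mapping.single a b + f"
    using update.hyps by (intro poly_mapping_eqI)
      (auto simp: lookup_update lookup_add lookup_single in_keys_iff when_def)
  then show ?case using assms(2) update by simp
qed

text \<open>Both sides are additive in f and in g, so two single terms remain. By determinism a run
  on a concatenation passes through exactly one state between the two words, and
  \<open>closed\<close> puts that state among the summation indices below K.\<close>

lemma path_sum_mult:
  assumes closed: "\<And>i x j. i < K \<Longrightarrow> \<delta> i x = Some j \<Longrightarrow> j < K" and i: "i < K"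
  shows "path_sum \<delta> (f * g) i j = (\<Sum>k<K. path_sum \<delta> f i k * path_sum \<delta> g k j)"
proof (induction f rule: poly_mapping_single_induct)
  case zero
  then show ?case by simp
next
  case (add u c f)
  have "path_sum \<delta> (Poly_Mapping.single u c * g) i j
      = (\<Sum>k<K. path_sum \<delta> (Poly_Mapping.single u c) i k * path_sum \<delta> g k j)"
  proof (induction g rule: poly_mapping_single_induct)
    case zero
    then show ?case by simp
  next
    case (add v e g)
    have "path_sum \<delta> (Poly_Mapping.single u c * Poly_Mapping.single v e) i j
      = (\<Sum>k<K. path_sum \<delta> (Poly_Mapping.single u c) i k * path_sum \<delta> (Poly_Mapping.single v e) k j)"
    proof (cases "run \<delta> i (letters u)")
      case None
      then show ?thesis by (simp add: mult_single path_sum_single plus_word_def run_append)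
    next
      case (Some l)
      have "l < K" using run_bounded[OF closed i Some] .
      have "(\<Sum>k<K. path_sum \<delta> (Poly_Mapping.single u c) i k * path_sum \<delta> (Poly_Mapping.single v e) k j)
        = (\<Sum>k<K. if k = l then c * path_sum \<delta> (Poly_Mapping.single v e) k j else 0)"
        by (rule sum.cong) (auto simp: path_sum_single Some)
      then show ?thesis using \<open>l < K\<close>
        by (simp add: mult_single path_sum_single plus_word_def run_append Some)
    qed
    then show ?case using add.IH
      by (simp add: distrib_left path_sum_add sum.distrib)
  qed
  then show ?case using add.IH by (simp add: distrib_right path_sum_add sum.distrib)
qed

section \<open>Isolating a word by a modular hash\<close>

text \<open>The value of a word in base \<open>-(n + 1)\<close>, up to sign, with digits \<open>1, \<dots>, n\<close>. The alternating sign lets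
  the program update a residue by counting down only.\<close>

definition word_value :: "nat \<Rightarrow> int \<Rightarrow> nat list \<Rightarrow> int" where
  "word_value n = foldl (\<lambda>a x. - (a * int (Suc n) + int x + 1))"

lemma word_value_simps [simp]:
  "word_value n a [] = a"
  "word_value n a (x # w) = word_value n (- (a * int (Suc n) + int x + 1)) w"
  "word_value n a (w @ [x]) = - (word_value n a w * int (Suc n) + int x + 1)"
  by (simp_all add: word_value_def)

text \<open>The last letter is determined modulo \<open>Suc n\<close>. Since the digits start at 1,
  a last digit is never divisible by \<open>Suc n\<close>; hence a nonempty word never has the value
  0 of the empty word, and words of different length are told apart as well.\<close>

lemma word_value_inj:
  assumes "word_value n 0 v = word_value n 0 w" "set v \<subseteq> {..<n}" "set w \<subseteq> {..<n}"
  shows "v = w"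
  using assms
proof (induction v arbitrary: w rule: rev_induct)
  case Nil
  show ?case
  proof (cases w rule: rev_cases)
    case (snoc w' x)
    then have "int (Suc x) = int (Suc n) * - word_value n 0 w'" using Nil by (simp add: algebra_simps)
    then have "int (Suc n) dvd int (Suc x)" by (rule dvdI)
    then have "Suc n \<le> Suc x" using dvd_imp_le of_nat_dvd_iff by blast
    then show ?thesis using Nil snoc by simp
  qed simp
next
  case (snoc y v)
  show ?case
  proof (cases w rule: rev_cases)
    case Nil
    then have "int (Suc y) = int (Suc n) * - word_value n 0 v" using snoc by (simp add: algebra_simps)
    then have "int (Suc n) dvd int (Suc y)" by (rule dvdI)
    then have "Suc n \<le> Suc y" using dvd_imp_le of_nat_dvd_iff by blast
    then show ?thesis using Nil snoc by simp
  next
    case w: (snoc w' x)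
    have e: "word_value n 0 v * int (Suc n) + int y = word_value n 0 w' * int (Suc n) + int x"
      using snoc.prems(1) w by simp
    have b: "int y < int (Suc n)" "int x < int (Suc n)" using snoc.prems w by auto
    have "(word_value n 0 v * int (Suc n) + int y) mod int (Suc n) = int y"
      "(word_value n 0 w' * int (Suc n) + int x) mod int (Suc n) = int x"
      using b by (simp_all del: of_nat_Suc)
    then have xy: "x = y" using e by (metis of_nat_eq_iff)
    then have "word_value n 0 v = word_value n 0 w'" using e by simp
    then show ?thesis using snoc.IH[of w'] snoc.prems w xy by simp
  qed
qed

lemma word_value_bound:
  assumes "set w \<subseteq> {..<n}"
  shows "\<bar>word_value n 0 w\<bar> < int (Suc n) ^ length w"
  using assms
proof (induction w rule: rev_induct)
  case (snoc x w)
  have "\<bar>word_value n 0 w\<bar> + 1 \<le> int (Suc n) ^ length w" using snoc by simp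
  then have "(\<bar>word_value n 0 w\<bar> + 1) * int (Suc n) \<le> int (Suc n) ^ length w * int (Suc n)"
    by (intro mult_right_mono) auto
  moreover have "\<bar>word_value n 0 (w @ [x])\<bar> \<le> \<bar>word_value n 0 w\<bar> * int (Suc n) + int x + 1"
  proof -
    have "\<bar>word_value n 0 w * int (Suc n)\<bar> = \<bar>word_value n 0 w\<bar> * int (Suc n)" by (simp only: abs_mult abs_of_nat)
    then show ?thesis unfolding word_value_simps by linarith
  qed
  moreover have "int x + 1 < int (Suc n)" using snoc by simp
  ultimately show ?case by (simp add: algebra_simps)
qed simp

lemma word_value_isolates:
  assumes fin: "finite S" and card: "card S \<le> t" and v: "v \<in> S"
    and S: "\<And>w. w \<in> S \<Longrightarrow> set w \<subseteq> {..<n} \<and> length w \<le> d"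
  shows "\<exists>m\<in>{1..2 * (Suc t * (Suc n * Suc d))}.
    \<forall>w\<in>S. word_value n 0 w mod int m = word_value n 0 v mod int m \<longrightarrow> w = v"
proof -
  have abs_prod_int: "\<bar>\<Prod>w\<in>A. g w\<bar> = (\<Prod>w\<in>A. \<bar>g w\<bar>)" for A and g :: "nat list \<Rightarrow> int"
    by (induction A rule: infinite_finite_induct) (simp_all add: abs_mult)
  define N where "N = (\<Prod>w\<in>S - {v}. word_value n 0 w - word_value n 0 v)"
  have N0: "N \<noteq> 0"
    unfolding N_def using fin S word_value_inj[of n _ v] v by auto
  have b: "\<bar>word_value n 0 w\<bar> < 2 ^ (n * d)" if "w \<in> S" for w
  proof -
    have "\<bar>word_value n 0 w\<bar> < int (Suc n) ^ length w" using word_value_bound S that by blast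
    also have "\<dots> \<le> int (Suc n) ^ d" using S that by (intro power_increasing) auto
    \<comment> \<open>A crude count of n bits per letter is enough for a polynomial bound.\<close>
    also have "int (Suc n) \<le> 2 ^ n" using less_exp[of n] by (simp flip: of_nat_Suc add: Suc_le_eq)
    then have "int (Suc n) ^ d \<le> (2 ^ n) ^ d" by (intro power_mono) auto
    finally show ?thesis by (simp add: power_mult)
  qed
  have "\<bar>N\<bar> = (\<Prod>w\<in>S - {v}. \<bar>word_value n 0 w - word_value n 0 v\<bar>)"  unfolding N_def abs_prod_int ..
  also have "\<dots> \<le> (\<Prod>w\<in>S - {v}. 2 ^ Suc (n * d))"
  proof (rule prod_mono)
    fix w assume "w \<in> S - {v}"
    then show "0 \<le> \<bar>word_value n 0 w - word_value n 0 v\<bar> \<and> \<bar>word_value n 0 w - word_value n 0 v\<bar> \<le> 2 ^ Suc (n * d)"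
      using b[of w] b[OF v] by auto
  qed
  also have "\<dots> = (2 ^ Suc (n * d)) ^ card (S - {v})" by simp
  also have "\<dots> = 2 ^ (Suc (n * d) * card (S - {v}))" by (simp only: power_mult)
  \<comment> \<open>The successors make the exponent exceed \<open>Suc (n * d) * t\<close> strictly.
    This also covers S = {v}, where N is the empty product 1.\<close>
  also have "\<dots> < 2 ^ (Suc t * (Suc n * Suc d))"
  proof (rule power_strict_increasing)
    have "card (S - {v}) \<le> t" using card card_Diff1_le[of S v] by linarith
    then have "Suc (n * d) * card (S - {v}) \<le> Suc (n * d) * t" by (rule mult_le_mono2)
    also have "\<dots> < Suc t * (Suc n * Suc d)" by (simp add: algebra_simps)
    finally show "Suc (n * d) * card (S - {v}) < Suc t * (Suc n * Suc d)" .
  qed simp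
  finally obtain m where m: "m \<in> {1..2 * (Suc t * (Suc n * Suc d))}" "\<not> int m dvd N"
    using ex_small_nondivisor[OF N0] by blast
  have "w = v" if "w \<in> S" "word_value n 0 w mod int m = word_value n 0 v mod int m" for w
  proof (rule ccontr)
    assume "w \<noteq> v"
    \<comment> \<open>A collision would make the modulus divide one factor of N, hence N.\<close>
    then have "(word_value n 0 w - word_value n 0 v) dvd N" unfolding N_def using that fin by (intro dvd_prodI) auto
    moreover have "int m dvd (word_value n 0 w - word_value n 0 v)" using that(2) by (simp add: mod_eq_dvd_iff)
    ultimately show False using m dvd_trans by blast
  qed
  then show ?thesis using m by blast
qed

text \<open>\<open>m\<close> is the largest residue, not the modulus. So the modulus is never 0, and
  \<open>m\<close> is the value to which a countdown wraps around.\<close>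

definition hash_step :: "nat \<Rightarrow> nat \<Rightarrow> nat \<Rightarrow> nat \<Rightarrow> nat" where
  "hash_step n m r x = nat ((- (int r * int (Suc n) + int x + 1)) mod int (Suc m))"

text \<open>State \<open>i < length u\<close> means that \<open>i\<close> letters of the prefix \<open>u\<close> have been read, state
  \<open>length u + r\<close> that all of \<open>u\<close> has been read and the rest of the word so far has residue \<open>r\<close>
  modulo \<open>m + 1\<close>.\<close>

definition prefix_hash :: "nat \<Rightarrow> nat list \<Rightarrow> nat \<Rightarrow> nat \<Rightarrow> nat \<Rightarrow> nat option" where
  "prefix_hash n u m i x =
     (if i < length u then (if u ! i = x then Some (Suc i) else None)
      else Some (length u + hash_step n m (i - length u) x))"

lemma hash_step_le: "hash_step n m r x \<le> m"
proof -
  have "(- (int r * int (Suc n) + int x + 1)) mod int (Suc m) < int (Suc m)"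
    by (rule pos_mod_bound) simp
  then show ?thesis unfolding hash_step_def by linarith
qed

lemma prefix_hash_closed:
  "i < length u + Suc m \<Longrightarrow> prefix_hash n u m i x = Some j \<Longrightarrow> j < length u + Suc m"
  using hash_step_le[of n m "i - length u" x] by (auto simp: prefix_hash_def split: if_splits)

text \<open>Letters are consumed from the left, so the induction needs an arbitrary start value
  \<open>a\<close>; the Horner step is compatible with reduction modulo
  \<open>Suc m\<close>.\<close>

lemma run_prefix_hash_residue:
  "run (prefix_hash n u m) (length u + nat (a mod int (Suc m))) v
    = Some (length u + nat (word_value n a v mod int (Suc m)))"
proof (induction v arbitrary: a)
  case (Cons x v)
  have "(- ((a mod int (Suc m)) * int (Suc n) + int x + 1)) mod int (Suc m)
      = (- (a * int (Suc n) + int x + 1)) mod int (Suc m)"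
    by (intro mod_minus_cong mod_add_cong) (simp_all del: of_nat_Suc add: mod_simps)
  then have "hash_step n m (nat (a mod int (Suc m))) x
      = nat ((- (a * int (Suc n) + int x + 1)) mod int (Suc m))"
    unfolding hash_step_def by (simp del: of_nat_Suc)
  then show ?case using Cons by (simp add: prefix_hash_def del: of_nat_Suc)
qed simp

lemma run_prefix_hash:
  assumes "i \<le> length u"
  shows "run (prefix_hash n u m) i w = Some (length u + a) \<longleftrightarrow>
    (\<exists>v. w = drop i u @ v \<and> nat (word_value n 0 v mod int (Suc m)) = a)"
  using assms
proof (induction w arbitrary: i)
  case Nil
  then show ?case by auto
next
  case (Cons x w)
  show ?case
  proof (cases "i = length u")
    case True
    then show ?thesis using run_prefix_hash_residue[of n u m 0 "x # w"] by (simp del: of_nat_Suc)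
  next
    case False
    then have i: "i < length u" using Cons by simp
    then have "drop i u = u ! i # drop (Suc i) u" by (simp add: Cons_nth_drop_Suc)
    then show ?thesis using Cons.IH[of "Suc i"] i by (auto simp: prefix_hash_def)
  qed
qed

lemma path_sum_prefix_hash:
  "path_sum (prefix_hash n u m) f 0 (length u + a) =
    (\<Sum>w\<in>nc_monomials f. if \<exists>v. letters w = u @ v \<and> nat (word_value n 0 v mod int (Suc m)) = a
        then nc_coeff f w else 0)"
  unfolding path_sum_def by (simp add: run_prefix_hash)

section \<open>Testing prefixes\<close>

definition live :: "'a::field ncpoly \<Rightarrow> nat list \<Rightarrow> bool" where
  "live f u \<longleftrightarrow> (\<exists>v. Word (u @ v) \<in> nc_monomials f)"

text \<open>A nonzero sum has a nonzero summand, which is a monomial with prefix u. Conversely, a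
  good modulus leaves a single summand. As only a lower bound is asked of M, the program may try all
  moduli up to a generous limit.\<close>

lemma live_iff_path_sum:
  fixes f :: "'a::field ncpoly"
  assumes deg: "\<And>w. w \<in> nc_monomials f \<Longrightarrow> set (letters w) \<subseteq> {..<n} \<and> length (letters w) \<le> d"
    and card: "card (nc_monomials f) \<le> t" and M: "2 * (Suc t * (Suc n * Suc d)) \<le> M"
  shows "live f u \<longleftrightarrow> (\<exists>m\<le>M. \<exists>a\<le>m. path_sum (prefix_hash n u m) f 0 (length u + a) \<noteq> 0)"
proof
  assume "\<exists>m\<le>M. \<exists>a\<le>m. path_sum (prefix_hash n u m) f 0 (length u + a) \<noteq> 0"
  then show "live f u"
  proof (elim exE conjE)
    fix m a assume "path_sum (prefix_hash n u m) f 0 (length u + a) \<noteq> 0"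
    then obtain w where "w \<in> nc_monomials f"
      "(if \<exists>v. letters w = u @ v \<and> nat (word_value n 0 v mod int (Suc m)) = a then nc_coeff f w else 0) \<noteq> 0"
      unfolding path_sum_prefix_hash by (rule sum.not_neutral_contains_not_neutral)
    then have "w \<in> nc_monomials f" "\<exists>v. letters w = u @ v" by (auto split: if_splits)
    then show "live f u" unfolding live_def by (metis word.collapse)
  qed
next
  assume "live f u"
  then obtain v where v: "Word (u @ v) \<in> nc_monomials f" unfolding live_def by blast
  \<comment> \<open>Only the part after \<open>u\<close> is hashed, so the words to be separated are
    these suffixes, again at most t.\<close>
  define S where "S = {v. Word (u @ v) \<in> nc_monomials f}"
  have inj: "inj_on (\<lambda>v. Word (u @ v)) S" by (auto intro: inj_onI)
  have sub: "(\<lambda>v. Word (u @ v)) ` S \<subseteq> nc_monomials f" unfolding S_def by auto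
  have fin: "finite S" using inj sub finite_imageD finite_subset finite_keys by metis
  have cardS: "card S \<le> t" using card_inj_on_le[OF inj sub] card by simp
  have "set w \<subseteq> {..<n} \<and> length w \<le> d" if "w \<in> S" for w
    using deg[of "Word (u @ w)"] that unfolding S_def by auto
  moreover have "v \<in> S" using v by (simp add: S_def)
  ultimately have "\<exists>m\<in>{1..2 * (Suc t * (Suc n * Suc d))}.
      \<forall>w\<in>S. word_value n 0 w mod int m = word_value n 0 v mod int m \<longrightarrow> w = v"
    by (intro word_value_isolates[OF fin cardS])
  then obtain m where m: "m \<in> {1..2 * (Suc t * (Suc n * Suc d))}"
    and iso: "\<And>w. w \<in> S \<Longrightarrow> word_value n 0 w mod int m = word_value n 0 v mod int m \<Longrightarrow> w = v"
    by blast
  \<comment> \<open>\<open>prefix_hash\<close> takes the modulus minus one.\<close>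
  obtain m' where m': "m = Suc m'" using m by (cases m) auto
  define a where "a = nat (word_value n 0 v mod int (Suc m'))"
  have "word_value n 0 v mod int (Suc m') < int (Suc m')" by (rule pos_mod_bound) simp
  then have "a \<le> m'" unfolding a_def by linarith
  have e: "(\<exists>v'. letters w = u @ v' \<and> nat (word_value n 0 v' mod int (Suc m')) = a) \<longleftrightarrow> w = Word (u @ v)"
    if "w \<in> nc_monomials f" for w
  proof
    assume "\<exists>v'. letters w = u @ v' \<and> nat (word_value n 0 v' mod int (Suc m')) = a"
    then obtain v' where v': "letters w = u @ v'" "nat (word_value n 0 v' mod int (Suc m')) = a" by blast
    have "word_value n 0 v' mod int m = word_value n 0 v mod int m"
      using v'(2) unfolding a_def m' by (simp add: eq_nat_nat_iff del: of_nat_Suc)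
    moreover have "v' \<in> S" using that v'(1) unfolding S_def by (metis mem_Collect_eq word.collapse)
    ultimately have "v' = v" using iso by blast
    then show "w = Word (u @ v)" using v'(1) by (metis word.collapse)
  qed (auto simp: a_def)
  have "path_sum (prefix_hash n u m') f 0 (length u + a)
    = (\<Sum>w\<in>nc_monomials f. if w = Word (u @ v) then nc_coeff f w else 0)"
    unfolding path_sum_prefix_hash by (rule sum.cong) (auto simp only: e)
  \<comment> \<open>Only one summand is left, so no cancellation can occur in any
    characteristic.\<close>
  also have "\<dots> \<noteq> 0" using v by (simp add: in_keys_iff)
  finally show "\<exists>m\<le>M. \<exists>a\<le>m. path_sum (prefix_hash n u m) f 0 (length u + a) \<noteq> 0"
    using m m' M \<open>a \<le> m'\<close> by (intro exI[of _ m']) auto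
qed

text \<open>Modulus 1 merges all continuations of u into one state. The base is irrelevant there and
  is fixed as 0; \<open>path_sum_prefix_sum\<close> changes to the base of the program.\<close>

definition prefix_sum :: "'a::field ncpoly \<Rightarrow> nat list \<Rightarrow> 'a" where
  "prefix_sum f u = path_sum (prefix_hash 0 u 0) f 0 (length u)"

lemma prefix_sum_eq:
  "prefix_sum f u = (\<Sum>w\<in>nc_monomials f. if \<exists>v. letters w = u @ v then nc_coeff f w else 0)"
  using path_sum_prefix_hash[of 0 u 0 f 0] by (simp add: prefix_sum_def)

lemma path_sum_prefix_sum: "path_sum (prefix_hash n u 0) f 0 (length u) = prefix_sum f u"
  using path_sum_prefix_hash[of n u 0 f 0] by (simp add: prefix_sum_eq)

lemma nc_coeff_prefix_sum:
  assumes "\<And>w. w \<in> nc_monomials f \<Longrightarrow> set (letters w) \<subseteq> {..<n}"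
  shows "nc_coeff f (Word u) = prefix_sum f u - (\<Sum>x<n. prefix_sum f (u @ [x]))"
proof -
  have "(\<Sum>x<n. prefix_sum f (u @ [x])) = (\<Sum>w\<in>nc_monomials f. \<Sum>x<n.
      if \<exists>v. letters w = (u @ [x]) @ v then nc_coeff f w else 0)"
    unfolding prefix_sum_eq by (rule sum.swap)
  also have "\<dots> = (\<Sum>w\<in>nc_monomials f. (if \<exists>v. letters w = u @ v then nc_coeff f w else 0)
       - (if w = Word u then nc_coeff f w else 0))"
  proof (rule sum.cong)
    fix w assume w: "w \<in> nc_monomials f"
    show "(\<Sum>x<n. if \<exists>v. letters w = (u @ [x]) @ v then nc_coeff f w else 0)
      = (if \<exists>v. letters w = u @ v then nc_coeff f w else 0) - (if w = Word u then nc_coeff f w else 0)"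
    proof (cases "\<exists>y v. letters w = u @ y # v")
      case True
      then obtain y v where y: "letters w = u @ y # v" by blast
      then have "y < n" using assms[OF w] by auto
      have "(\<Sum>x<n. if \<exists>v. letters w = (u @ [x]) @ v then nc_coeff f w else 0)
        = (\<Sum>x<n. if x = y then nc_coeff f w else 0)"
        by (rule sum.cong) (auto simp: y)
      then show ?thesis using y \<open>y < n\<close> by auto
    next
      case False
      have "(\<Sum>x<n. if \<exists>v. letters w = (u @ [x]) @ v then nc_coeff f w else 0) = 0"
        using False by (intro sum.neutral) auto
      moreover have "(\<exists>v. letters w = u @ v) \<longleftrightarrow> w = Word u"
        using False by (metis append_Nil2 neq_Nil_conv word.collapse word.sel)
      ultimately show ?thesis by simp
    qed
  qed simp
  finally show ?thesis unfolding prefix_sum_eq[of f u]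
    by (simp add: sum_subtractf in_keys_iff)
qed

lemma card_live:
  "card {u. length u = k \<and> live f u} \<le> card (nc_monomials f)"
proof -
  have "{u. length u = k \<and> live f u} \<subseteq> (\<lambda>w. take k (letters w)) ` nc_monomials f"
    unfolding live_def by force
  then show ?thesis using surj_card_le[OF finite_keys] by blast
qed

lemma finite_live: "finite {u. length u = k \<and> live f u}"
proof -
  have "{u. length u = k \<and> live f u} \<subseteq> (\<lambda>w. take k (letters w)) ` nc_monomials f"
    unfolding live_def by force
  then show ?thesis by (rule finite_subset) simp
qed

section \<open>Letters of the polynomial computed by a circuit\<close>

lemma length_foldl_gate_poly: "length (foldl (\<lambda>fs g. fs @ [gate_poly fs g]) fs gs) = length fs + length gs"
  by (induction gs arbitrary: fs) auto

definition poly_letters :: "nat \<Rightarrow> 'a::field ncpoly \<Rightarrow> bool" where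
  "poly_letters n f \<longleftrightarrow> (\<forall>w\<in>nc_monomials f. set (letters w) \<subseteq> {..<n})"

lemma poly_letters_gate_poly:
  assumes "wf_gate n (length fs) g" "\<forall>f\<in>set fs. poly_letters n f"
  shows "poly_letters n (gate_poly fs g)"
proof (cases g)
  case (Plus j k)
  then have "poly_letters n (fs ! j)" "poly_letters n (fs ! k)" using assms by auto
  then show ?thesis using Plus keys_add[of "fs ! j" "fs ! k"] by (auto simp: poly_letters_def)
next
  case (Times j k)
  show ?thesis unfolding poly_letters_def
  proof
    fix w assume "w \<in> nc_monomials (gate_poly fs g)"
    then obtain a b where "w = a + b" "a \<in> nc_monomials (fs ! j)" "b \<in> nc_monomials (fs ! k)"
      using keys_mult[of "fs ! j" "fs ! k"] Times by auto
    moreover have "poly_letters n (fs ! j)" "poly_letters n (fs ! k)" using assms Times by auto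
    ultimately show "set (letters w) \<subseteq> {..<n}"
      by (auto simp: poly_letters_def plus_word_def)
  qed
qed (use assms in \<open>auto simp: poly_letters_def nc_var_def nc_const_def zero_word_def\<close>)

lemma poly_letters_gate_polys:
  assumes "\<forall>p<length gs. wf_gate n (length fs + p) (gs ! p)" "\<forall>f\<in>set fs. poly_letters n f"
  shows "\<forall>f\<in>set (foldl (\<lambda>fs g. fs @ [gate_poly fs g]) fs gs). poly_letters n f"
  using assms
proof (induction gs arbitrary: fs)
  case (Cons g gs)
  have "wf_gate n (length fs) g" using Cons.prems(1) by force
  then have "poly_letters n (gate_poly fs g)" using Cons.prems poly_letters_gate_poly by blast
  moreover have "\<forall>p<length gs. wf_gate n (length (fs @ [gate_poly fs g]) + p) (gs ! p)"
    using Cons.prems(1) by force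
  ultimately show ?case using Cons.IH[of "fs @ [gate_poly fs g]"] Cons.prems by simp
qed simp

text \<open>Injectivity of \<open>word_value\<close> and the restriction of the search to letters
  below n both rest on this.\<close>

lemma poly_letters_circuit_poly:
  assumes "wf_circuit n C"
  shows "poly_letters n (circuit_poly C)"
proof -
  have "\<forall>f\<in>set (gate_polys (gates C)). poly_letters n f"
    unfolding gate_polys_def
    by (rule poly_letters_gate_polys) (use assms in \<open>auto simp: wf_circuit_def\<close>)
  moreover have "circuit_poly C \<in> set (gate_polys (gates C))"
    unfolding circuit_poly_def
    by (rule nth_mem) (use assms in \<open>auto simp: wf_circuit_def gate_polys_def length_foldl_gate_poly\<close>)
  ultimately show ?thesis by (rule bspec)
qed

lemma length_le_nc_degree: "w \<in> nc_monomials f \<Longrightarrow> length (letters w) \<le> nc_degree f"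
  unfolding nc_degree_def by (intro Max_ge) auto


declare One_nat_def [simp del]

section \<open>Symbolic execution of programs\<close>

text \<open>The postcondition also receives the number of steps, so values and running times are
  proved together. Existence of an evaluation is what \<open>reconstructs_within\<close> asks
  for.\<close>

definition wp :: "prog \<Rightarrow> 'a::field val list \<Rightarrow> expr \<Rightarrow> ('a val \<Rightarrow> nat \<Rightarrow> bool) \<Rightarrow> bool" where
  "wp P env e Q \<longleftrightarrow> (\<exists>v T. eval P env e v T \<and> Q v T)"

definition wps :: "prog \<Rightarrow> 'a::field val list \<Rightarrow> expr list \<Rightarrow> ('a val list \<Rightarrow> nat \<Rightarrow> bool) \<Rightarrow> bool" where
  "wps P env es Q \<longleftrightarrow> (\<exists>vs T. evals P env es vs T \<and> Q vs T)"

text \<open>A call with its body still folded. Symbolic execution stops here, and the specification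
  of the called function takes over.\<close>

definition wp_fn :: "prog \<Rightarrow> nat \<Rightarrow> 'a::field val list \<Rightarrow> ('a val \<Rightarrow> nat \<Rightarrow> bool) \<Rightarrow> bool" where
  "wp_fn P f us Q \<longleftrightarrow> f < length P \<and> wp P us (P ! f) Q"

text \<open>These congruence rules make the simplifier execute a program from left to right: it never
  works on the continuation before the value passed to it is known.\<close>

lemma wp_cong [cong]: "env = env' \<Longrightarrow> e = e' \<Longrightarrow> wp P env e Q = wp P env' e' Q"
  and wps_cong [cong]: "env = env' \<Longrightarrow> es = es' \<Longrightarrow> wps P env es R = wps P env' es' R"
  and wp_fn_cong [cong]: "us = us' \<Longrightarrow> wp_fn P f us Q = wp_fn P f us' Q"
  by simp_all

inductive_cases eval_elims:
  "eval P env (Var i) v T" "eval P env EmptyE v T" "eval P env (PairE a b) v T"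
  "eval P env (FstE a) v T" "eval P env (SndE a) v T" "eval P env (IfEmpty c a b) v T"
  "eval P env ZeroE v T" "eval P env OneE v T" "eval P env (AddE a b) v T"
  "eval P env (SubE a b) v T" "eval P env (MulE a b) v T" "eval P env (IfZero c a b) v T"
  "eval P env (LetE a b) v T" "eval P env (CallE f es) v T"

inductive_cases evals_elims: "evals P env [] vs T" "evals P env (a # es) vs T"

lemma wp_simps [simp]:
  "wp P env (Var i) Q \<longleftrightarrow> i < length env \<and> Q (env ! i) 1"
  "wp P env EmptyE Q \<longleftrightarrow> Q Empty 1"
  "wp P env (PairE a b) Q \<longleftrightarrow>
    wp P env a (\<lambda>u S. wp P env b (\<lambda>v T. Q (Pair u v) (S + T + 1)))"
  "wp P env (FstE a) Q \<longleftrightarrow> wp P env a (\<lambda>w T. \<exists>u v. w = Pair u v \<and> Q u (T + 1))"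
  "wp P env (SndE a) Q \<longleftrightarrow> wp P env a (\<lambda>w T. \<exists>u v. w = Pair u v \<and> Q v (T + 1))"
  "wp P env (IfEmpty c a b) Q \<longleftrightarrow> wp P env c (\<lambda>u S. 
    if u = Empty then wp P env a (\<lambda>v T. Q v (S + T + 1)) else wp P env b (\<lambda>v T. Q v (S + T + 1)))"
  "wp P env ZeroE Q \<longleftrightarrow> Q (Scalar 0) 1"
  "wp P env OneE Q \<longleftrightarrow> Q (Scalar 1) 1"
  "wp P env (AddE a b) Q \<longleftrightarrow> wp P env a (\<lambda>u S. \<exists>x. u = Scalar x \<and>
    wp P env b (\<lambda>v T. \<exists>y. v = Scalar y \<and> Q (Scalar (x + y)) (S + T + 1)))"
  "wp P env (SubE a b) Q \<longleftrightarrow> wp P env a (\<lambda>u S. \<exists>x. u = Scalar x \<and>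
    wp P env b (\<lambda>v T. \<exists>y. v = Scalar y \<and> Q (Scalar (x - y)) (S + T + 1)))"
  "wp P env (MulE a b) Q \<longleftrightarrow> wp P env a (\<lambda>u S. \<exists>x. u = Scalar x \<and>
    wp P env b (\<lambda>v T. \<exists>y. v = Scalar y \<and> Q (Scalar (x * y)) (S + T + 1)))"
  "wp P env (IfZero c a b) Q \<longleftrightarrow> wp P env c (\<lambda>u S. \<exists>x. u = Scalar x \<and>
    (if x = 0 then wp P env a (\<lambda>v T. Q v (S + T + 1)) else wp P env b (\<lambda>v T. Q v (S + T + 1))))"
  "wp P env (LetE a b) Q \<longleftrightarrow>
    wp P env a (\<lambda>u S. wp P (u # env) b (\<lambda>v T. Q v (S + T + 1)))"
  "wp P env (CallE f es) Q \<longleftrightarrow>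
    wps P env es (\<lambda>us S. wp_fn P f us (\<lambda>v T. Q v (S + T + 1)))"
  "wps P env [] R \<longleftrightarrow> R [] 0"
  "wps P env (a # es) R \<longleftrightarrow>
    wp P env a (\<lambda>u S. wps P env es (\<lambda>us T. R (u # us) (S + T)))"
  unfolding wp_fn_def wp_def wps_def
  by (auto intro: eval_evals.intros elim!: eval_elims evals_elims split: if_splits; metis eval_evals.intros)+

lemma nth_Cons_1 [simp]: "(x # xs) ! 1 = xs ! 0"
  by (simp add: One_nat_def)

lemma one_less_Suc [simp]: "1 < Suc k \<longleftrightarrow> 0 < k" "1 \<le> Suc k"
  by (simp_all add: One_nat_def)

lemma enc_list_eq_Empty_iff [simp]: "enc_list xs = Empty \<longleftrightarrow> xs = []"
  by (cases xs) auto

lemma enc_nat_eq_Empty_iff [simp]: "enc_nat k = Empty \<longleftrightarrow> k = 0"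
  by (cases k) auto

text \<open>List functions thus double as arithmetic: appending adds unary numbers, and any list can
  serve as a counter through its length.\<close>

lemma enc_nat_conv_list: "enc_nat k = enc_list (replicate k Empty)"
  by (induction k) auto

abbreviation enc_vec :: "'a::field list \<Rightarrow> 'a val" where
  "enc_vec xs \<equiv> enc_list (map Scalar xs)"

abbreviation enc_mat :: "'a::field list list \<Rightarrow> 'a val" where
  "enc_mat A \<equiv> enc_list (map (\<lambda>r. enc_list (map Scalar r)) A)"

abbreviation enc_word :: "nat list \<Rightarrow> 'a::field val" where
  "enc_word u \<equiv> enc_list (map enc_nat u)"

abbreviation enc_bool :: "bool \<Rightarrow> 'a::field val" where
  "enc_bool b \<equiv> (if b then Pair Empty Empty else Empty)"

section \<open>The program\<close>

text \<open>Position 0 is left free for the entry expression, which is put in front of the library.\<close>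

abbreviation (input) "append_fn \<equiv> 1 :: nat"
abbreviation (input) "mult_fn \<equiv> 2 :: nat"
abbreviation (input) "nth_fn \<equiv> 3 :: nat"
abbreviation (input) "drop_fn \<equiv> 4 :: nat"
abbreviation (input) "eq_fn \<equiv> 5 :: nat"
abbreviation (input) "dec_fn \<equiv> 6 :: nat"
abbreviation (input) "unit_fn \<equiv> 7 :: nat"
abbreviation (input) "axpy_fn \<equiv> 8 :: nat"
abbreviation (input) "vecmat_fn \<equiv> 9 :: nat"
abbreviation (input) "matmul_fn \<equiv> 10 :: nat"
abbreviation (input) "madd_fn \<equiv> 11 :: nat"
abbreviation (input) "diag_fn \<equiv> 12 :: nat"
abbreviation (input) "chain_fn \<equiv> 13 :: nat"
abbreviation (input) "resid_fn \<equiv> 14 :: nat"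
abbreviation (input) "varmat_fn \<equiv> 15 :: nat"
abbreviation (input) "gate_fn \<equiv> 16 :: nat"
abbreviation (input) "gates_fn \<equiv> 17 :: nat"
abbreviation (input) "sums_fn \<equiv> 18 :: nat"
abbreviation (input) "nonzero_fn \<equiv> 19 :: nat"
abbreviation (input) "live_fn \<equiv> 20 :: nat"
abbreviation (input) "prefix_fn \<equiv> 21 :: nat"
abbreviation (input) "coeff_fn \<equiv> 22 :: nat"
abbreviation (input) "children_fn \<equiv> 23 :: nat"
abbreviation (input) "level_fn \<equiv> 24 :: nat"
abbreviation (input) "terms_fn \<equiv> 25 :: nat"
abbreviation (input) "search_fn \<equiv> 26 :: nat"
abbreviation (input) "solve_fn \<equiv> 27 :: nat"

section \<open>Lists and unary numbers\<close>

definition append_code :: expr where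
  "append_code = IfEmpty (Var 0) (Var 1)
    (PairE (FstE (Var 0)) (CallE append_fn [SndE (Var 0), Var 1]))"

definition mult_code :: expr where
  "mult_code = IfEmpty (Var 0) EmptyE
    (CallE append_fn [Var 1, CallE mult_fn [SndE (Var 0), Var 1]])"

definition nth_code :: expr where
  "nth_code = IfEmpty (Var 1) (FstE (Var 0)) (CallE nth_fn [SndE (Var 0), SndE (Var 1)])"

text \<open>The second list is only a counter. Running off the end of the first one must be
  tolerated, because rows may lack trailing zeros.\<close>

definition drop_code :: expr where
  "drop_code = IfEmpty (Var 1) (Var 0)
    (IfEmpty (Var 0) EmptyE (CallE drop_fn [SndE (Var 0), SndE (Var 1)]))"

definition eq_code :: expr where
  "eq_code = IfEmpty (Var 0) (IfEmpty (Var 1) (PairE EmptyE EmptyE) EmptyE)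
    (IfEmpty (Var 1) EmptyE (CallE eq_fn [SndE (Var 0), SndE (Var 1)]))"

text \<open>The arguments are the number of decrements, the current residue and the largest residue.
  Reloading an exhausted residue counts as one decrement, since -1 is congruent to the largest
  residue.\<close>

definition dec_code :: expr where
  "dec_code = IfEmpty (Var 0) (Var 1) (IfEmpty (Var 1)
    (CallE dec_fn [SndE (Var 0), Var 2, Var 2]) (CallE dec_fn [SndE (Var 0), SndE (Var 1), Var 2]))"

section \<open>Vectors and matrices\<close>

definition unit_code :: expr where
  "unit_code = IfEmpty (Var 0) (PairE (Var 1) EmptyE)
    (PairE ZeroE (CallE unit_fn [SndE (Var 0), Var 1]))"

definition axpy_code :: expr where
  "axpy_code = IfEmpty (Var 1) (Var 2) (IfEmpty (Var 2)
    (PairE (MulE (Var 0) (FstE (Var 1))) (CallE axpy_fn [Var 0, SndE (Var 1), EmptyE]))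
    (PairE (AddE (MulE (Var 0) (FstE (Var 1))) (FstE (Var 2)))
      (CallE axpy_fn [Var 0, SndE (Var 1), SndE (Var 2)])))"

definition vecmat_code :: expr where
  "vecmat_code = IfEmpty (Var 0) EmptyE (IfEmpty (Var 1) EmptyE
    (CallE axpy_fn [FstE (Var 0), FstE (Var 1), CallE vecmat_fn [SndE (Var 0), SndE (Var 1)]]))"

definition matmul_code :: expr where
  "matmul_code = IfEmpty (Var 0) EmptyE
    (PairE (CallE vecmat_fn [FstE (Var 0), Var 1]) (CallE matmul_fn [SndE (Var 0), Var 1]))"

definition madd_code :: expr where
  "madd_code = IfEmpty (Var 0) EmptyE (IfEmpty (Var 1) EmptyE
    (PairE (CallE axpy_fn [OneE, FstE (Var 0), FstE (Var 1)])
      (CallE madd_fn [SndE (Var 0), SndE (Var 1)])))"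

definition diag_code :: expr where
  "diag_code = IfEmpty (Var 1) EmptyE (PairE (CallE unit_fn [Var 0, Var 2])
    (CallE diag_fn [PairE EmptyE (Var 0), SndE (Var 1), Var 2]))"

section \<open>Transition matrices of the prefix hash\<close>

definition chain_code :: expr where
  "chain_code = IfEmpty (Var 1) (Var 3) (PairE
    (IfEmpty (CallE eq_fn [FstE (Var 1), Var 2]) EmptyE
      (CallE unit_fn [PairE EmptyE (Var 0), OneE]))
    (CallE chain_fn [PairE EmptyE (Var 0), SndE (Var 1), Var 2, Var 3]))"

text \<open>The arguments are the target residue of the current row, the number of rows left, the
  base, the largest residue and the prefix. The prefix contributes only its length, as the offset of
  the residue states.\<close>

definition resid_code :: expr where
  "resid_code = IfEmpty (Var 1) EmptyE (PairE
    (CallE unit_fn [CallE append_fn [Var 4, Var 0], OneE])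
    (CallE resid_fn [CallE dec_fn [Var 2, Var 0, Var 3], SndE (Var 1), Var 2, Var 3, Var 4]))"

definition varmat_code :: expr where
  "varmat_code = CallE chain_fn [EmptyE, Var 1, Var 0,
    CallE resid_fn [CallE dec_fn [PairE EmptyE (Var 0), EmptyE, Var 2], PairE EmptyE (Var 2),
      PairE EmptyE (Var 3), Var 2, Var 1]]"

section \<open>Evaluating the circuit and reading off sums\<close>

definition gate_code :: expr where
  "gate_code = IfEmpty (FstE (Var 0)) (CallE varmat_fn [SndE (Var 0), Var 2, Var 3, Var 4])
    (IfEmpty (SndE (FstE (Var 0)))
      (CallE diag_fn [EmptyE, CallE append_fn [Var 2, PairE EmptyE (Var 3)], SndE (Var 0)])
    (IfEmpty (SndE (SndE (FstE (Var 0))))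
      (CallE madd_fn [CallE nth_fn [Var 1, FstE (SndE (Var 0))], CallE nth_fn [Var 1, SndE (SndE (Var 0))]])
      (CallE matmul_fn [CallE nth_fn [Var 1, FstE (SndE (Var 0))], CallE nth_fn [Var 1, SndE (SndE (Var 0))]])))"

definition gates_code :: expr where
  "gates_code = IfEmpty (Var 0) (Var 1) (CallE gates_fn [SndE (Var 0),
    CallE append_fn [Var 1, PairE (CallE gate_fn [FstE (Var 0), Var 1, Var 2, Var 3, Var 4]) EmptyE],
    Var 2, Var 3, Var 4])"

text \<open>The first row belongs to the start state. Its columns before \<open>length u\<close>
  belong to incomplete prefixes and are cut off, which leaves one sum per residue.\<close>

definition sums_code :: expr where
  "sums_code = CallE drop_fn [FstE (CallE nth_fn
    [CallE gates_fn [FstE (Var 0), EmptyE, Var 1, Var 2, Var 3], SndE (Var 0)]), Var 1]"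

definition nonzero_code :: expr where
  "nonzero_code = IfEmpty (Var 0) EmptyE
    (IfZero (FstE (Var 0)) (CallE nonzero_fn [SndE (Var 0)]) (PairE EmptyE EmptyE))"

section \<open>Prefix tests, coefficients and the search\<close>

definition live_code :: expr where
  "live_code = IfEmpty (CallE nonzero_fn [CallE sums_fn [Var 1, Var 2, Var 0, Var 3]])
    (IfEmpty (Var 0) EmptyE (CallE live_fn [SndE (Var 0), Var 1, Var 2, Var 3]))
    (PairE EmptyE EmptyE)"

definition prefix_code :: expr where
  "prefix_code = LetE (CallE sums_fn [Var 0, Var 1, EmptyE, Var 2])
    (IfEmpty (Var 0) ZeroE (FstE (Var 0)))"

definition coeff_code :: expr where
  "coeff_code = IfEmpty (Var 0) (Var 1) (CallE coeff_fn [SndE (Var 0),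
    SubE (Var 1) (CallE prefix_fn
      [Var 2, CallE append_fn [Var 3, PairE (SndE (Var 0)) EmptyE], Var 4]),
    Var 2, Var 3, Var 4])"

definition children_code :: expr where
  "children_code = IfEmpty (Var 0) (Var 2)
    (LetE (CallE append_fn [Var 1, PairE (SndE (Var 0)) EmptyE])
      (CallE children_fn [SndE (Var 1), Var 2,
        IfEmpty (CallE live_fn [Var 6, Var 4, Var 0, Var 5]) (Var 3) (PairE (Var 0) (Var 3)),
        Var 4, Var 5, Var 6]))"

definition level_code :: expr where
  "level_code = IfEmpty (Var 0) EmptyE (CallE children_fn [Var 2, FstE (Var 0),
    CallE level_fn [SndE (Var 0), Var 1, Var 2, Var 3], Var 1, Var 2, Var 3])"

definition terms_code :: expr where
  "terms_code = IfEmpty (Var 0) (Var 1)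
    (LetE (CallE coeff_fn [Var 3, CallE prefix_fn [Var 2, FstE (Var 0), Var 3], Var 2, FstE (Var 0), Var 3])
      (LetE (CallE terms_fn [SndE (Var 1), Var 2, Var 3, Var 4])
        (IfZero (Var 1) (Var 0) (PairE (PairE (FstE (Var 2)) (Var 1)) (Var 0)))))"

definition search_code :: expr where
  "search_code = CallE terms_fn [Var 1,
    IfEmpty (Var 0) EmptyE (CallE search_fn
      [SndE (Var 0), CallE level_fn [Var 1, Var 2, Var 3, Var 4], Var 2, Var 3, Var 4]),
    Var 2, Var 3]"

text \<open>\<open>PairE EmptyE\<close> acts as successor on unary numbers. In the call of the
  search, \<open>PairE EmptyE EmptyE\<close> is the list whose only element is the empty word, and
  appending a number to itself doubles it.\<close>

definition solve_code :: expr where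
  "solve_code = LetE (CallE mult_fn [PairE EmptyE (Var 3),
      CallE mult_fn [PairE EmptyE (Var 1), PairE EmptyE (Var 2)]])
    (CallE search_fn [Var 3, PairE EmptyE EmptyE, Var 1, Var 2, CallE append_fn [Var 0, Var 0]])"

definition library :: prog where
  "library = [append_code, mult_code, nth_code, drop_code, eq_code, dec_code, unit_code, axpy_code,
    vecmat_code, matmul_code, madd_code, diag_code, chain_code, resid_code, varmat_code, gate_code,
    gates_code, sums_code, nonzero_code, live_code, prefix_code, coeff_code, children_code,
    level_code, terms_code, search_code, solve_code]"

text \<open>The entry expression stays arbitrary, so one library serves both halves of the theorem.
  These are not global simplification rules: recursive cases unfold one call by \<open>subst\<close>
  and leave the next one to the induction hypothesis.\<close>

lemma wp_fn_library:
  "wp_fn (e # library) append_fn us Q \<longleftrightarrow> wp (e # library) us append_code Q"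
  "wp_fn (e # library) mult_fn us Q \<longleftrightarrow> wp (e # library) us mult_code Q"
  "wp_fn (e # library) nth_fn us Q \<longleftrightarrow> wp (e # library) us nth_code Q"
  "wp_fn (e # library) drop_fn us Q \<longleftrightarrow> wp (e # library) us drop_code Q"
  "wp_fn (e # library) eq_fn us Q \<longleftrightarrow> wp (e # library) us eq_code Q"
  "wp_fn (e # library) dec_fn us Q \<longleftrightarrow> wp (e # library) us dec_code Q"
  "wp_fn (e # library) unit_fn us Q \<longleftrightarrow> wp (e # library) us unit_code Q"
  "wp_fn (e # library) axpy_fn us Q \<longleftrightarrow> wp (e # library) us axpy_code Q"
  "wp_fn (e # library) vecmat_fn us Q \<longleftrightarrow> wp (e # library) us vecmat_code Q"
  "wp_fn (e # library) matmul_fn us Q \<longleftrightarrow> wp (e # library) us matmul_code Q"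
  "wp_fn (e # library) madd_fn us Q \<longleftrightarrow> wp (e # library) us madd_code Q"
  "wp_fn (e # library) diag_fn us Q \<longleftrightarrow> wp (e # library) us diag_code Q"
  "wp_fn (e # library) chain_fn us Q \<longleftrightarrow> wp (e # library) us chain_code Q"
  "wp_fn (e # library) resid_fn us Q \<longleftrightarrow> wp (e # library) us resid_code Q"
  "wp_fn (e # library) varmat_fn us Q \<longleftrightarrow> wp (e # library) us varmat_code Q"
  "wp_fn (e # library) gate_fn us Q \<longleftrightarrow> wp (e # library) us gate_code Q"
  "wp_fn (e # library) gates_fn us Q \<longleftrightarrow> wp (e # library) us gates_code Q"
  "wp_fn (e # library) sums_fn us Q \<longleftrightarrow> wp (e # library) us sums_code Q"
  "wp_fn (e # library) nonzero_fn us Q \<longleftrightarrow> wp (e # library) us nonzero_code Q"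
  "wp_fn (e # library) live_fn us Q \<longleftrightarrow> wp (e # library) us live_code Q"
  "wp_fn (e # library) prefix_fn us Q \<longleftrightarrow> wp (e # library) us prefix_code Q"
  "wp_fn (e # library) coeff_fn us Q \<longleftrightarrow> wp (e # library) us coeff_code Q"
  "wp_fn (e # library) children_fn us Q \<longleftrightarrow> wp (e # library) us children_code Q"
  "wp_fn (e # library) level_fn us Q \<longleftrightarrow> wp (e # library) us level_code Q"
  "wp_fn (e # library) terms_fn us Q \<longleftrightarrow> wp (e # library) us terms_code Q"
  "wp_fn (e # library) search_fn us Q \<longleftrightarrow> wp (e # library) us search_code Q"
  "wp_fn (e # library) solve_fn us Q \<longleftrightarrow> wp (e # library) us solve_code Q"
  by (simp_all add: wp_fn_def library_def)

section \<open>Correctness and running time of the library functions\<close>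

text \<open>The specifications share this form: equations for the arguments, so that they match
  whatever term execution has produced, and an arbitrary postcondition, so that they chain. The
  numerical constants are generous.\<close>

lemma append_fn:
  assumes "v = enc_list xs" "w = enc_list ys"
    "\<And>r T. r = enc_list (xs @ ys) \<Longrightarrow> T \<le> 20 * (length xs + 1) \<Longrightarrow> Q r T"
  shows "wp_fn (e # library) append_fn [v, w] Q"
  using assms
proof (induction xs arbitrary: v w Q)
  case Nil
  then show ?case by (simp add: wp_fn_library append_code_def)
next
  case (Cons x xs)
  note prems = Cons.prems
  show ?case
    apply (subst wp_fn_library)
    apply (simp add: append_code_def prems(1,2))
    apply (rule Cons.IH; simp?)
    apply (rule prems(3); simp)
    done
qed

lemma mult_fn:
  assumes "v = enc_list xs" "w = enc_nat b"
    "\<And>r T. r = enc_nat (length xs * b) \<Longrightarrow> T \<le> (20 * b + 40) * (length xs + 1) \<Longrightarrow> Q r T"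
  shows "wp_fn (e # library) mult_fn [v, w] Q"
  using assms
proof (induction xs arbitrary: v w Q)
  case Nil
  then show ?case by (simp add: wp_fn_library mult_code_def)
next
  case (Cons x xs)
  note prems = Cons.prems
  show ?case
    apply (subst wp_fn_library)
    apply (simp add: mult_code_def prems(1,2))
    apply (rule Cons.IH; simp?)
    apply (rule append_fn[where xs = "replicate b Empty" and ys = "replicate (length xs * b) Empty"];
        simp add: enc_nat_conv_list)
    apply (rule prems(3); simp add: enc_nat_conv_list replicate_add algebra_simps)
    done
qed

lemma nth_fn:
  assumes "v = enc_list xs" "w = enc_nat i" "i < length xs"
    "\<And>r T. r = xs ! i \<Longrightarrow> T \<le> 20 * (i + 1) \<Longrightarrow> Q r T"
  shows "wp_fn (e # library) nth_fn [v, w] Q"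
  using assms
proof (induction xs arbitrary: v w i Q)
  case (Cons x xs)
  note prems = Cons.prems
  show ?case
  proof (cases i)
    case 0
    then show ?thesis using prems by (simp add: wp_fn_library nth_code_def)
  next
    case (Suc j)
    show ?thesis
      apply (subst wp_fn_library)
      apply (simp add: nth_code_def prems(1,2) Suc)
      apply (rule Cons.IH; (simp only: )?)
      using prems Suc by simp_all
  qed
qed simp

lemma drop_fn:
  assumes "v = enc_list xs" "w = enc_list ys"
    "\<And>r T. r = enc_list (drop (length ys) xs) \<Longrightarrow> T \<le> 20 * (length ys + 1) \<Longrightarrow> Q r T"
  shows "wp_fn (e # library) drop_fn [v, w] Q"
  using assms
proof (induction ys arbitrary: v w xs Q)
  case Nil
  then show ?case by (simp add: wp_fn_library drop_code_def)
next
  case (Cons y ys)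
  note prems = Cons.prems
  show ?case
  proof (cases xs)
    case Nil
    then show ?thesis using prems by (simp add: wp_fn_library drop_code_def)
  next
    case xs: (Cons x xs')
    show ?thesis
      apply (subst wp_fn_library)
      apply (simp add: drop_code_def prems(1,2) xs)
      apply (rule Cons.IH; simp?)
      using prems xs by simp_all
  qed
qed

lemma eq_fn:
  assumes "v = enc_nat a" "w = enc_nat b"
    "\<And>r T. r = enc_bool (a = b) \<Longrightarrow> T \<le> 20 * (b + 1) \<Longrightarrow> Q r T"
  shows "wp_fn (e # library) eq_fn [v, w] Q"
  using assms
proof (induction a arbitrary: v w b Q)
  case 0
  then show ?case by (cases b) (simp_all add: wp_fn_library eq_code_def)
next
  case (Suc a)
  note prems = Suc.prems
  show ?case
  proof (cases b)
    case 0
    then show ?thesis using prems by (simp add: wp_fn_library eq_code_def)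
  next
    case b: (Suc b')
    show ?thesis
      apply (subst wp_fn_library)
      apply (simp add: eq_code_def prems(1,2) b)
      apply (rule Suc.IH; (simp only: )?)
      using prems b by simp_all
  qed
qed

fun dec :: "nat \<Rightarrow> nat \<Rightarrow> nat \<Rightarrow> nat" where
  "dec 0 q m = q"
| "dec (Suc k) 0 m = dec k m m"
| "dec (Suc k) (Suc q) m = dec k q m"

lemma dec_le: "q \<le> m \<Longrightarrow> dec k q m \<le> m"
  by (induction k q m rule: dec.induct) auto

lemma dec_mod: "q \<le> m \<Longrightarrow> int (dec k q m) = (int q - int k) mod int (Suc m)"
proof (induction k q m rule: dec.induct)
  case (2 k m)
  have "(int m - int k) mod int (Suc m) = (- int (Suc k) + int (Suc m)) mod int (Suc m)"
    by (rule arg_cong[where f = "\<lambda>x. x mod int (Suc m)"]) simp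
  then show ?case using 2 by (simp del: of_nat_Suc)
qed auto

lemma dec_fn:
  assumes "v = enc_nat k" "w = enc_nat q" "z = enc_nat m"
    "\<And>r T. r = enc_nat (dec k q m) \<Longrightarrow> T \<le> 20 * (k + 1) \<Longrightarrow> Q r T"
  shows "wp_fn (e # library) dec_fn [v, w, z] Q"
  using assms
proof (induction k arbitrary: v w z q Q)
  case 0
  then show ?case by (simp add: wp_fn_library dec_code_def)
next
  case (Suc k)
  note prems = Suc.prems
  show ?case
  proof (cases q)
    case 0
    show ?thesis
      apply (subst wp_fn_library)
      apply (simp add: dec_code_def prems(1-3) 0)
      apply (rule Suc.IH[where q = m]; (simp only: )?)
      using prems 0 by simp_all
  next
    case q: (Suc q')
    show ?thesis
      apply (subst wp_fn_library)
      apply (simp add: dec_code_def prems(1-3) q)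
      apply (rule Suc.IH[where q = q']; (simp only: )?)
      using prems q by simp_all
  qed
qed

section \<open>Rows without trailing zeros and their arithmetic\<close>

definition unit_vec :: "nat \<Rightarrow> 'a::field \<Rightarrow> 'a list" where
  "unit_vec i c = replicate i 0 @ [c]"

lemma length_unit_vec [simp]: "length (unit_vec i c) = Suc i"
  by (simp add: unit_vec_def)

lemma unit_fn:
  assumes "v = enc_list xs" "w = Scalar c"
    "\<And>r T. r = enc_vec (unit_vec (length xs) c) \<Longrightarrow> T \<le> 20 * (length xs + 1) \<Longrightarrow> Q r T"
  shows "wp_fn (e # library) unit_fn [v, w] Q"
  using assms
proof (induction xs arbitrary: v w Q)
  case Nil
  then show ?case by (simp add: wp_fn_library unit_code_def unit_vec_def)
next
  case (Cons x xs)
  note prems = Cons.prems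
  show ?case
    apply (subst wp_fn_library)
    apply (simp add: unit_code_def prems(1,2))
    apply (rule Cons.IH; simp?)
    apply (rule prems(3); simp add: unit_vec_def)
    done
qed

text \<open>The linear combination c * u + v, where the shorter operand counts as padded with
  zeros.\<close>

fun axpy :: "'a::field \<Rightarrow> 'a list \<Rightarrow> 'a list \<Rightarrow> 'a list" where
  "axpy c [] v = v"
| "axpy c (x # u) [] = c * x # axpy c u []"
| "axpy c (x # u) (y # v) = (c * x + y) # axpy c u v"

lemma length_axpy: "length (axpy c u v) = max (length u) (length v)"
  by (induction c u v rule: axpy.induct) auto

lemma axpy_fn:
  assumes "v = Scalar c" "w = enc_vec xs" "z = enc_vec ys"
    "\<And>r T. r = enc_vec (axpy c xs ys) \<Longrightarrow> T \<le> 30 * (length xs + 1) \<Longrightarrow> Q r T"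
  shows "wp_fn (e # library) axpy_fn [v, w, z] Q"
  using assms
proof (induction xs arbitrary: v w z ys Q)
  case Nil
  then show ?case by (simp add: wp_fn_library axpy_code_def)
next
  case (Cons x xs)
  note prems = Cons.prems
  show ?case
  proof (cases ys)
    case Nil
    show ?thesis
      apply (subst wp_fn_library)
      apply (simp add: axpy_code_def prems(1-3) Nil)
      apply (rule Cons.IH[where ys = "[]"]; (simp add: prems(1))?)
      using prems Nil by simp_all
  next
    case ys: (Cons y ys')
    show ?thesis
      apply (subst wp_fn_library)
      apply (simp add: axpy_code_def prems(1-3) ys)
      apply (rule Cons.IH[where ys = ys']; (simp add: prems(1))?)
      using prems ys by simp_all
  qed
qed

text \<open>The row vector times the matrix is formed as a combination of rows, which avoids any
  access to columns.\<close>

fun vecmat :: "'a::field list \<Rightarrow> 'a list list \<Rightarrow> 'a list" where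
  "vecmat (x # v) (r # M) = axpy x r (vecmat v M)"
| "vecmat _ _ = []"

lemma length_vecmat: "\<forall>r\<in>set M. length r \<le> K \<Longrightarrow> length (vecmat v M) \<le> K"
  by (induction v M rule: vecmat.induct) (auto simp: length_axpy)

lemma vecmat_fn:
  assumes "v = enc_vec xs" "w = enc_mat M" "\<forall>r\<in>set M. length r \<le> K"
    "\<And>r T. r = enc_vec (vecmat xs M) \<Longrightarrow> T \<le> 60 * (K + 1) * (length xs + 1) \<Longrightarrow> Q r T"
  shows "wp_fn (e # library) vecmat_fn [v, w] Q"
  using assms
proof (induction xs arbitrary: v w M Q)
  case Nil
  then show ?case by (simp add: wp_fn_library vecmat_code_def)
next
  case (Cons x xs)
  note prems = Cons.prems
  show ?case
  proof (cases M)
    case Nil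
    show ?thesis
      apply (subst wp_fn_library)
      apply (simp add: vecmat_code_def prems(1,2) Nil)
      using prems Nil by simp_all
  next
    case M: (Cons r M')
    then have r: "length r \<le> K" using prems by simp
    show ?thesis
      apply (subst wp_fn_library)
      apply (simp add: vecmat_code_def prems(1,2) M)
      apply (rule Cons.IH[where M = M']; (simp only: )?)
      subgoal using prems M by simp
      apply simp
      apply (rule axpy_fn[where c = x and xs = r and ys = "vecmat xs M'"]; (simp only: )?)
      apply (rule prems(4))
       apply (simp add: M)
      using r by (simp add: algebra_simps)
  qed
qed

lemma matmul_fn:
  assumes "v = enc_mat A" "w = enc_mat B"
    "\<forall>r\<in>set A. length r \<le> K" "\<forall>r\<in>set B. length r \<le> K"
    "\<And>r T. r = enc_mat (map (\<lambda>r. vecmat r B) A) \<Longrightarrow>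
      T \<le> (60 * (K + 1) * (K + 1) + 20) * (length A + 1) \<Longrightarrow> Q r T"
  shows "wp_fn (e # library) matmul_fn [v, w] Q"
  using assms
proof (induction A arbitrary: v w Q)
  case Nil
  then show ?case by (simp add: wp_fn_library matmul_code_def)
next
  case (Cons a A)
  note prems = Cons.prems
  have "60 * (K + 1) * (length a + 1) \<le> 60 * (K + 1) * (K + 1)" using prems(3) by simp
  note le = order_trans[OF _ this]
  show ?case
    apply (subst wp_fn_library)
    apply (simp add: matmul_code_def prems(1,2))
    apply (rule vecmat_fn[where xs = a and M = B, OF _ _ prems(4)]; (simp only: )?)
    apply (drule le)
    apply simp
    apply (rule Cons.IH; (simp only: )?)
    subgoal using prems by simp
    subgoal using prems by simp
    apply simp
    apply (rule prems(5))
     apply simp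
    apply (simp add: algebra_simps)
    done
qed

lemma madd_fn:
  assumes "v = enc_mat A" "w = enc_mat B" "\<forall>r\<in>set A. length r \<le> K"
    "\<And>r T. r = enc_mat (map2 (axpy 1) A B) \<Longrightarrow> T \<le> 60 * (K + 1) * (length A + 1) \<Longrightarrow> Q r T"
  shows "wp_fn (e # library) madd_fn [v, w] Q"
  using assms
proof (induction A arbitrary: v w B Q)
  case Nil
  then show ?case by (simp add: wp_fn_library madd_code_def)
next
  case (Cons a A)
  note prems = Cons.prems
  show ?case
  proof (cases B)
    case Nil
    show ?thesis
      apply (subst wp_fn_library)
      apply (simp add: madd_code_def prems(1,2) Nil)
      using prems Nil by simp_all
  next
    case B: (Cons b B')
    then have a: "length a \<le> K" using prems by simp
    show ?thesis
      apply (subst wp_fn_library)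
      apply (simp add: madd_code_def prems(1,2) B)
      apply (rule axpy_fn[where c = 1 and xs = a and ys = b]; (simp only: )?)
      apply simp
      apply (rule Cons.IH[where B = B']; (simp only: )?)
      subgoal using prems by simp
      apply simp
      apply (rule prems(4))
       apply (simp add: B)
      using a by (simp add: algebra_simps)
  qed
qed

fun diag_rows :: "nat \<Rightarrow> nat \<Rightarrow> 'a::field \<Rightarrow> 'a list list" where
  "diag_rows i 0 c = []"
| "diag_rows i (Suc k) c = unit_vec i c # diag_rows (Suc i) k c"

lemma diag_fn:
  assumes "v = enc_nat i" "w = enc_list ys" "z = Scalar c"
    "\<And>r T. r = enc_mat (diag_rows i (length ys) c) \<Longrightarrow>
      T \<le> 60 * (i + length ys + 1) * (length ys + 1) \<Longrightarrow> Q r T"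
  shows "wp_fn (e # library) diag_fn [v, w, z] Q"
  using assms
proof (induction ys arbitrary: v w z i Q)
  case Nil
  then show ?case by (simp add: wp_fn_library diag_code_def)
next
  case (Cons y ys)
  note prems = Cons.prems
  show ?case
    apply (subst wp_fn_library)
    apply (simp add: diag_code_def prems(1-3))
    apply (rule unit_fn[where xs = "replicate i Empty" and c = c]; (simp only: enc_nat_conv_list)?)
    apply simp
    apply (rule Cons.IH[where i = "Suc i"]; (simp only: )?)
    subgoal by (simp add: enc_nat_conv_list)
    apply simp
    apply (rule prems(4))
    apply (simp_all add: algebra_simps)
    done
qed

text \<open>Rows of the states inside the prefix. An undefined transition is the empty row, which
  stands for a zero row.\<close>

fun chain_rows :: "nat \<Rightarrow> nat list \<Rightarrow> nat \<Rightarrow> 'a::field list list" where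
  "chain_rows i [] x = []"
| "chain_rows i (y # u) x = (if y = x then unit_vec (Suc i) 1 else []) # chain_rows (Suc i) u x"

lemma chain_fn:
  assumes "v = enc_nat i" "w = enc_word u" "z = enc_nat x" "rest = enc_mat R"
    "\<And>r T. r = enc_mat (chain_rows i u x @ R) \<Longrightarrow>
      T \<le> (20 * x + 20 * (i + length u) + 150) * (length u + 1) \<Longrightarrow> Q r T"
  shows "wp_fn (e # library) chain_fn [v, w, z, rest] Q"
  using assms
proof (induction u arbitrary: v w z rest i Q)
  case Nil
  then show ?case by (simp add: wp_fn_library chain_code_def)
next
  case (Cons y u)
  note prems = Cons.prems
  show ?case
    apply (subst wp_fn_library)
    apply (simp add: chain_code_def prems(1-4))
    apply (rule eq_fn[where a = y and b = x]; (simp only: )?)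
    apply (cases "y = x")
     apply simp
     apply (rule unit_fn[where xs = "replicate (Suc i) Empty" and c = 1])
       apply (simp add: enc_nat_conv_list)
      apply (rule refl)
     apply simp
     apply (rule Cons.IH[where i = "Suc i"]; (simp add: prems(1-4))?)
     apply (rule prems(5))
      apply simp
     apply (simp add: algebra_simps)
    apply simp
    apply (rule Cons.IH[where i = "Suc i"]; (simp add: prems(1-4))?)
    apply (rule prems(5))
     apply simp
    apply (simp add: algebra_simps)
    done
qed

text \<open>The residue reached from r by x is -(r * (n + 1) + x + 1), so with \<open>b\<close> = n
  + 1 each target arises from the previous one by \<open>b\<close> decrements, without any
  multiplication.\<close>

fun resid_rows :: "nat \<Rightarrow> nat \<Rightarrow> nat \<Rightarrow> nat \<Rightarrow> nat \<Rightarrow> 'a::field list list" where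
  "resid_rows q 0 b m k = []"
| "resid_rows q (Suc p) b m k = unit_vec (k + q) 1 # resid_rows (dec b q m) p b m k"

lemma resid_fn:
  assumes "v = enc_nat q" "w = enc_nat p" "z = enc_nat b" "z' = enc_nat m" "z'' = enc_list ks" "q \<le> m"
    "\<And>r T. r = enc_mat (resid_rows q p b m (length ks)) \<Longrightarrow>
      T \<le> (20 * (2 * length ks + m + b) + 150) * (p + 1) \<Longrightarrow> Q r T"
  shows "wp_fn (e # library) resid_fn [v, w, z, z', z''] Q"
  using assms
proof (induction p arbitrary: v w z z' z'' q Q)
  case 0
  then show ?case by (simp add: wp_fn_library resid_code_def)
next
  case (Suc p)
  note prems = Suc.prems
  show ?case
    apply (subst wp_fn_library)
    apply (simp add: resid_code_def prems(1-5))
    apply (rule append_fn[where xs = ks and ys = "replicate q Empty"]; (simp only: enc_nat_conv_list)?)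
    apply simp
    apply (rule unit_fn[where xs = "ks @ replicate q Empty" and c = 1]; (simp only: )?)
    apply simp
    apply (rule dec_fn[where k = b and q = q and m = m]; (simp only: enc_nat_conv_list)?)
    apply (simp only: enc_nat_conv_list[symmetric])
    apply simp
    apply (rule Suc.IH[where q = "dec b q m"]; (simp add: prems dec_le enc_nat_conv_list)?)
    apply (rule prems(7))
     apply simp
    using prems(6) apply (simp add: algebra_simps)
    done
qed

lemma varmat_fn:
  assumes "v = enc_nat x" "w = enc_word u" "z = enc_nat m" "z' = enc_nat n" "x < n"
    "K = length u + Suc m"
    "\<And>r T. r = enc_mat (chain_rows 0 u x @ resid_rows (dec (Suc x) 0 m) (Suc m) (Suc n) m (length u)) \<Longrightarrow>
      T \<le> 600 * (K + n + 1) * (K + 1) \<Longrightarrow> Q r T"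
  shows "wp_fn (e # library) varmat_fn [v, w, z, z'] Q"
proof -
  \<comment> \<open>Each block has at most K rows, and a row costs time linear in K + n. The third
    fact adds the two blocks and the countdown for the first residue.\<close>
  have 1: "(20 * (2 * length u + m + Suc n) + 150) * (Suc m + 1) \<le> (40 * K + 40 * n + 200) * (K + 1)"
    using assms(6) by (intro mult_mono) auto
  have 2: "(20 * x + 20 * (0 + length u) + 150) * (length u + 1) \<le> (40 * K + 20 * n + 200) * (K + 1)"
    using assms(5,6) by (intro mult_mono) auto
  have 3: "(40 * K + 40 * n + 200) * (K + 1) + (40 * K + 20 * n + 200) * (K + 1) + 20 * (x + 3) + 50
    \<le> 600 * (K + n + 1) * (K + 1)"
    using assms(5) by (simp add: algebra_simps)
  show ?thesis
    apply (subst wp_fn_library)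
    apply (simp add: varmat_code_def assms(1-4))
    apply (rule dec_fn[where k = "Suc x" and q = 0 and m = m]; (simp; fail)?)
    apply simp
    apply (rule resid_fn[where q = "dec (Suc x) 0 m" and p = "Suc m" and b = "Suc n" and m = m
          and ks = "map enc_nat u"]; (simp add: dec_le; fail)?)
    apply (simp del: resid_rows.simps)
    apply (rule chain_fn[where i = 0 and u = u and x = x
          and R = "resid_rows (dec (Suc x) 0 m) (Suc m) (Suc n) m (length u)"]; (simp; fail)?)
    apply (rule assms(7))
     apply simp
    using 1 2 3 apply simp
    done
qed

text \<open>Trailing zeros of a vector may be omitted.\<close>

definition vnth :: "'a::field list \<Rightarrow> nat \<Rightarrow> 'a" where
  "vnth v j = (if j < length v then v ! j else 0)"

lemma vnth_simps [simp]:
  "vnth [] j = 0" "vnth (x # v) 0 = x" "vnth (x # v) (Suc j) = vnth v j"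
  by (simp_all add: vnth_def)

lemma vnth_axpy: "vnth (axpy c u v) j = c * vnth u j + vnth v j"
proof (induction c u v arbitrary: j rule: axpy.induct)
  case (2 c x u)
  then show ?case by (cases j) auto
next
  case (3 c x u y v)
  then show ?case by (cases j) auto
qed simp

lemma vnth_unit_vec: "vnth (unit_vec i c) j = (if j = i then c else 0)"
  by (auto simp: vnth_def unit_vec_def nth_append)

text \<open>The formula holds for all lengths: entries of v beyond the rows of M are ignored on both
  sides, and missing ones count as 0.\<close>

lemma vnth_vecmat: "vnth (vecmat v M) j = (\<Sum>k<length M. vnth v k * vnth (M ! k) j)"
  by (induction v M rule: vecmat.induct) (simp_all add: vnth_axpy sum.lessThan_Suc_shift del: sum.lessThan_Suc)

text \<open>Rows may be shorter than K, but not longer; this limit also enters the time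
  bounds.\<close>

definition represents :: "nat \<Rightarrow> (nat \<Rightarrow> nat \<Rightarrow> 'a::field) \<Rightarrow> 'a list list \<Rightarrow> bool" where
  "represents K F A \<longleftrightarrow> length A = K \<and> (\<forall>r\<in>set A. length r \<le> K) \<and>
    (\<forall>i<K. \<forall>j<K. vnth (A ! i) j = F i j)"

lemma represents_cong:
  "(\<And>i j. i < K \<Longrightarrow> F i j = G i j) \<Longrightarrow> represents K F A \<longleftrightarrow> represents K G A"
  by (simp add: represents_def)

lemma represents_madd:
  assumes "represents K F A" "represents K G B"
  shows "represents K (\<lambda>i j. F i j + G i j) (map2 (axpy 1) A B)"
  using assms unfolding represents_def
  by (auto simp: vnth_axpy length_axpy elim!: in_set_zipE)

lemma represents_matmul:
  assumes "represents K F A" "represents K G B"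
  shows "represents K (\<lambda>i j. \<Sum>k<K. F i k * G k j) (map (\<lambda>r. vecmat r B) A)"
  using assms unfolding represents_def by (auto simp: vnth_vecmat intro: length_vecmat)

lemma length_diag_rows [simp]: "length (diag_rows i k c) = k"
  by (induction i k c rule: diag_rows.induct) auto

lemma nth_diag_rows: "j < k \<Longrightarrow> diag_rows i k c ! j = unit_vec (i + j) c"
proof (induction i k c arbitrary: j rule: diag_rows.induct)
  case (2 i k c)
  then show ?case by (cases j) auto
qed simp

lemma represents_diag: "represents K (\<lambda>i j. if i = j then c else 0) (diag_rows 0 K c)"
  unfolding represents_def by (auto simp: nth_diag_rows vnth_unit_vec in_set_conv_nth)

lemma length_chain_rows [simp]: "length (chain_rows i u x) = length u"
  by (induction i u x rule: chain_rows.induct) auto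

lemma nth_chain_rows:
  "j < length u \<Longrightarrow> chain_rows i u x ! j = (if u ! j = x then unit_vec (Suc (i + j)) 1 else [])"
proof (induction i u x arbitrary: j rule: chain_rows.induct)
  case (2 i y u x)
  then show ?case by (cases j) auto
qed simp

lemma length_resid_rows [simp]: "length (resid_rows q p b m k) = p"
  by (induction q p b m k rule: resid_rows.induct) auto

lemma nth_resid_rows:
  "j < p \<Longrightarrow> q \<le> m \<Longrightarrow>
    resid_rows q p b m k ! j = unit_vec (k + nat ((int q - int j * int b) mod int (Suc m))) 1"
proof (induction q p b m k arbitrary: j rule: resid_rows.induct)
  case (2 q p b m k)
  show ?case
  proof (cases j)
    case 0
    then show ?thesis using 2 by simp
  next
    case (Suc i)
    have "(int (dec b q m) - int i * int b) mod int (Suc m) = (int q - int j * int b) mod int (Suc m)"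
      unfolding dec_mod[OF 2(3)] mod_diff_left_eq Suc by (simp add: algebra_simps)
    then show ?thesis using 2 Suc by (simp add: dec_le del: of_nat_Suc)
  qed
qed simp

lemma represents_varmat:
  assumes "K = length u + Suc m"
  shows "represents K (\<lambda>i j. if prefix_hash n u m i x = Some j then 1 else 0)
    (chain_rows 0 u x @ resid_rows (dec (Suc x) 0 m) (Suc m) (Suc n) m (length u))"
    (is "represents K ?F ?A")
proof -
  have row: "?A ! i = (case prefix_hash n u m i x of None \<Rightarrow> [] | Some j \<Rightarrow> unit_vec j 1)" if "i < K" for i
  proof (cases "i < length u")
    case True
    then show ?thesis by (simp add: nth_append nth_chain_rows prefix_hash_def)
  next
    case False
    then have l: "i - length u < Suc m" using that assms by simp
    \<comment> \<open>The first target is -(x + 1), and the row of residue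
      \<open>i - length u\<close> lies that many steps of size \<open>Suc n\<close> lower.\<close>
    have "(int (dec (Suc x) 0 m) - int (i - length u) * int (Suc n)) mod int (Suc m)
      = (- (int (i - length u) * int (Suc n) + int x + 1)) mod int (Suc m)"
      unfolding dec_mod[OF le0] mod_diff_left_eq by (simp add: algebra_simps)
    then show ?thesis using False l
      by (simp add: nth_append nth_resid_rows dec_le prefix_hash_def hash_step_def del: of_nat_Suc resid_rows.simps)
  qed
  have "length r \<le> K" if r: "r \<in> set ?A" for r
  proof -
    obtain i where i: "i < K" "r = ?A ! i"
      using r assms unfolding in_set_conv_nth by (auto simp del: resid_rows.simps)
    show ?thesis
    proof (cases "prefix_hash n u m i x")
      case (Some j)
      then have "j < K" using prefix_hash_closed i(1) assms by blast
      then show ?thesis unfolding i(2) row[OF i(1)] Some by simp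
    next
      case None
      then show ?thesis unfolding i(2) row[OF i(1)] by simp
    qed
  qed
  moreover have "vnth (?A ! i) j = ?F i j" if "i < K" for i j
    unfolding row[OF that] by (auto simp: vnth_unit_vec split: option.splits)
  moreover have "length ?A = K" using assms by (simp del: resid_rows.simps)
  ultimately show ?thesis unfolding represents_def by blast
qed

lemma path_sum_var: "path_sum \<delta> (nc_var x) = (\<lambda>i j. if \<delta> i x = Some j then 1 else 0)"
  by (intro ext) (simp add: nc_var_def path_sum_single split: option.splits)

lemma path_sum_const: "path_sum \<delta> (nc_const c) = (\<lambda>i j. if i = j then c else 0)"
  by (intro ext) (simp add: nc_const_def path_sum_single zero_word_def)

lemma enc_nat_numerals: "enc_nat 1 = Pair Empty Empty" "enc_nat 2 = Pair Empty (Pair Empty Empty)"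
  "enc_nat 3 = Pair Empty (Pair Empty (Pair Empty Empty))"
  by (simp_all add: One_nat_def numeral_eq_Suc)

definition gate_time :: "nat \<Rightarrow> nat \<Rightarrow> nat \<Rightarrow> nat" where
  "gate_time K n sz = 600 * (K + n + 1) * (K + 1) + (60 * (K + 1) * (K + 1) + 20) * (K + 1)
     + 100 * (K + 1) * (K + 1) + 40 * (sz + 1) + 100"

text \<open>The polynomials \<open>fs\<close> occur only in the invariant and are never computed.
  Neither their degrees nor their numbers of monomials enter \<open>gate_time\<close>.\<close>

lemma gate_fn:
  assumes "v = enc_gate g" "w = enc_list (map enc_mat As)" "z = enc_word u" "z' = enc_nat m" "z'' = enc_nat n"
    and rep: "list_all2 (\<lambda>A f. represents K (path_sum (prefix_hash n u m) f) A) As fs"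
    and wf: "wf_gate n (length fs) g" and K: "K = length u + Suc m" and sz: "length fs \<le> sz"
    and Q: "\<And>r T A. r = enc_mat A \<Longrightarrow> represents K (path_sum (prefix_hash n u m) (gate_poly fs g)) A \<Longrightarrow>
      T \<le> gate_time K n sz \<Longrightarrow> Q r T"
  shows "wp_fn (e # library) gate_fn [v, w, z, z', z''] Q"
proof (cases g)
  case (Input x)
  then have x: "x < n" using wf by simp
  show ?thesis
    apply (subst wp_fn_library)
    apply (simp add: gate_code_def assms(1-5) Input)
    apply (rule varmat_fn[OF refl refl refl refl x K])
    apply (rule Q)
      apply assumption
    subgoal using represents_varmat[OF K] by (simp only: Input gate_poly.simps path_sum_var)
    apply (simp add: gate_time_def)
    done
next
  case (Const c)
  have l: "length (map enc_nat u @ replicate (Suc m) Empty) = K" using K by simp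
  show ?thesis
    apply (subst wp_fn_library)
    apply (simp add: gate_code_def assms(1-5) Const enc_nat_numerals)
    apply (rule append_fn[where xs = "map enc_nat u" and ys = "replicate (Suc m) Empty"];
        (simp add: enc_nat_conv_list; fail)?)
    apply simp
    apply (rule diag_fn[where i = 0 and ys = "map enc_nat u @ replicate (Suc m) Empty" and c = c];
        (simp; fail)?)
    apply (unfold l)
    apply (rule Q)
      apply assumption
     apply (simp add: Const path_sum_const represents_diag)
    using K apply (simp add: gate_time_def)
    done
next
  case (Plus j k)
  have jk: "j < length fs" "k < length fs" using wf Plus by auto
  have len: "length As = length fs" using rep by (rule list_all2_lengthD)
  have R: "represents K (path_sum (prefix_hash n u m) (fs ! j)) (As ! j)"
    "represents K (path_sum (prefix_hash n u m) (fs ! k)) (As ! k)"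
    using list_all2_nthD[OF rep] jk len by auto
  then have lA: "length (As ! j) = K" "\<forall>r\<in>set (As ! j). length r \<le> K" by (auto simp: represents_def)
  show ?thesis
    apply (subst wp_fn_library)
    apply (simp add: gate_code_def assms(1-5) Plus enc_nat_numerals)
    apply (rule nth_fn[where xs = "map enc_mat As" and i = j]; (simp add: jk len; fail)?)
    apply simp
    apply (rule nth_fn[where xs = "map enc_mat As" and i = k]; (simp add: jk len; fail)?)
    apply simp
    apply (rule madd_fn[where A = "As ! j" and B = "As ! k" and K = K]; (simp add: jk len lA; fail)?)
    apply (rule Q)
      apply assumption
    subgoal using represents_madd[OF R] by (simp add: Plus path_sum_add[abs_def])
    using jk sz lA apply (simp add: gate_time_def algebra_simps)
    done
next
  case (Times j k)
  have jk: "j < length fs" "k < length fs" using wf Times by auto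
  have len: "length As = length fs" using rep by (rule list_all2_lengthD)
  have R: "represents K (path_sum (prefix_hash n u m) (fs ! j)) (As ! j)"
    "represents K (path_sum (prefix_hash n u m) (fs ! k)) (As ! k)"
    using list_all2_nthD[OF rep] jk len by auto
  then have lA: "length (As ! j) = K" "\<forall>r\<in>set (As ! j). length r \<le> K" "\<forall>r\<in>set (As ! k). length r \<le> K"
    by (auto simp: represents_def)
  have mult: "path_sum (prefix_hash n u m) (fs ! j * fs ! k) i l =
    (\<Sum>p<K. path_sum (prefix_hash n u m) (fs ! j) i p * path_sum (prefix_hash n u m) (fs ! k) p l)"
    if "i < K" for i l
    by (rule path_sum_mult[OF _ that]) (unfold K, rule prefix_hash_closed)
  \<comment> \<open>The product formula is available only for start states below K, the only rows
    that \<open>represents\<close> inspects.\<close>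
  have prod: "represents K (path_sum (prefix_hash n u m) (fs ! j * fs ! k))
      (map (\<lambda>r. vecmat r (As ! k)) (As ! j))"
    by (subst represents_cong[OF mult]) (assumption, rule represents_matmul[OF R])
  show ?thesis
    apply (subst wp_fn_library)
    apply (simp add: gate_code_def assms(1-5) Times enc_nat_numerals)
    apply (rule nth_fn[where xs = "map enc_mat As" and i = j]; (simp add: jk len; fail)?)
    apply simp
    apply (rule nth_fn[where xs = "map enc_mat As" and i = k]; (simp add: jk len; fail)?)
    apply simp
    apply (rule matmul_fn[where A = "As ! j" and B = "As ! k" and K = K]; (simp add: jk len lA; fail)?)
    apply (rule Q)
      apply assumption
    subgoal using prod by (simp add: Times)
    using jk sz lA apply (simp add: gate_time_def)
    done
qed

lemma gates_fn:
  assumes "v = enc_list (map enc_gate gs)" "w = enc_list (map enc_mat As)" "z = enc_word u"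
    "z' = enc_nat m" "z'' = enc_nat n"
    "list_all2 (\<lambda>A f. represents K (path_sum (prefix_hash n u m) f) A) As fs"
    "\<forall>p<length gs. wf_gate n (length fs + p) (gs ! p)" "K = length u + Suc m"
    "length fs + length gs \<le> sz"
    "\<And>r T As'. r = enc_list (map enc_mat As') \<Longrightarrow>
      list_all2 (\<lambda>A f. represents K (path_sum (prefix_hash n u m) f) A) As'
        (foldl (\<lambda>fs g. fs @ [gate_poly fs g]) fs gs) \<Longrightarrow>
      T \<le> (gate_time K n sz + 20 * (sz + 1) + 40) * (length gs + 1) \<Longrightarrow> Q r T"
  shows "wp_fn (e # library) gates_fn [v, w, z, z', z''] Q"
  using assms
proof (induction gs arbitrary: v w z z' z'' As fs Q)
  case Nil
  then show ?case by (auto simp add: wp_fn_library gates_code_def)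
next
  case (Cons g gs)
  note prems = Cons.prems
  have wf: "wf_gate n (length fs) g" using prems(7) by force
  have wf': "\<forall>p<length gs. wf_gate n (length (fs @ [gate_poly fs g]) + p) (gs ! p)"
    using prems(7) by force
  have len: "length As = length fs" using prems(6) by (rule list_all2_lengthD)
  have sz: "length fs \<le> sz" using prems(9) by simp
  show ?case
    apply (subst wp_fn_library)
    apply (simp add: gates_code_def prems(1-5))
    apply (rule gate_fn[OF refl refl refl refl refl prems(6) wf prems(8) sz])
    subgoal for r T A
      apply simp
      apply (rule append_fn[where xs = "map enc_mat As" and ys = "[enc_mat A]"]; (simp; fail)?)
      apply simp
      apply (rule Cons.IH[where As = "As @ [A]" and fs = "fs @ [gate_poly fs g]", OF _ _ _ _ _ _ wf' prems(8)];
          (simp; fail)?)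
      subgoal using prems(6) by (simp add: list_all2_appendI)
      subgoal using prems(9) by simp
      apply (rule prems(10))
        apply assumption
       apply simp
      using len sz apply (simp add: algebra_simps)
      done
    done
qed

definition sums_time :: "nat \<Rightarrow> nat \<Rightarrow> nat \<Rightarrow> nat" where
  "sums_time K n sz = (gate_time K n sz + 20 * (sz + 1) + 40) * (sz + 1) + 20 * (sz + 1) + 20 * (K + 1) + 60"

lemma sums_time_mono: "K \<le> K' \<Longrightarrow> sums_time K n sz \<le> sums_time K' n sz"
  unfolding sums_time_def gate_time_def by (intro add_mono mult_mono) auto

lemma sums_fn:
  assumes "v = enc_circuit C" "w = enc_word u" "z = enc_nat m" "z' = enc_nat n"
    and wf: "wf_circuit n C" and K: "length u + Suc m \<le> K"
    and Q: "\<And>r T s. r = enc_vec s \<Longrightarrow> length s \<le> Suc m \<Longrightarrow>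
      (\<And>a. a \<le> m \<Longrightarrow> vnth s a = path_sum (prefix_hash n u m) (circuit_poly C) 0 (length u + a)) \<Longrightarrow>
      T \<le> sums_time K n (circuit_size C) \<Longrightarrow> Q r T"
  shows "wp_fn (e # library) sums_fn [v, w, z, z'] Q"
proof -
  \<comment> \<open>\<open>L\<close> is the exact number of states, which \<open>represents\<close>
    requires; \<open>K\<close> is a common upper bound that serves all prefixes and moduli.\<close>
  define L where "L = length u + Suc m"
  define sz where "sz = length (gates C)"
  have out: "out C < sz" "\<forall>p<length (gates C). wf_gate n (length ([] :: 'a ncpoly list) + p) (gates C ! p)"
    using wf by (auto simp: wf_circuit_def sz_def)
  have L0: "0 < L" and L_le: "L \<le> K" and u_le: "length u \<le> L" unfolding L_def using K by auto
  show ?thesis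
    apply (subst wp_fn_library)
    apply (simp add: sums_code_def assms(1-4) enc_circuit_def)
    apply (rule gates_fn[OF refl _ refl refl refl _ out(2) L_def, where As = "[]" and sz = sz];
        (simp add: sz_def; fail)?)
    subgoal for r T As
      apply (fold gate_polys_def)
      apply (subgoal_tac "length As = sz \<and> represents L (path_sum (prefix_hash n u m) (circuit_poly C)) (As ! out C)")
       prefer 2
      subgoal premises p
      proof -
        have "length As = sz"
          using list_all2_lengthD[OF p(2)] by (simp add: gate_polys_def length_foldl_gate_poly sz_def)
        then show ?thesis using list_all2_nthD[OF p(2), of "out C"] out(1) by (simp add: circuit_poly_def)
      qed
      apply (elim conjE)
      apply simp
      apply (rule nth_fn[where xs = "map enc_mat As" and i = "out C"]; (simp add: out; fail)?)
      apply (subgoal_tac "\<exists>s A. As ! out C = s # A")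
       prefer 2
      subgoal using L0 by (cases "As ! out C") (auto simp: represents_def)
      apply (elim exE)
      subgoal for r' T' s A
        apply (simp add: out)
        apply (rule drop_fn[where xs = "map Scalar s" and ys = "map enc_nat u"]; (simp; fail)?)
        apply (rule Q[where s = "drop (length u) s"])
           apply (simp add: drop_map)
        subgoal by (auto simp: represents_def L_def)
        subgoal premises p for r'' T'' a
        proof -
          have "vnth s (length u + a) = path_sum (prefix_hash n u m) (circuit_poly C) 0 (length u + a)"
            using p L0 unfolding represents_def L_def by (metis (no_types, lifting) add_le_mono1 add.commute le_imp_less_Suc nat_add_left_cancel_less nth_Cons_0)
          then show ?thesis by (auto simp: vnth_def less_diff_conv add.commute split: if_splits)
        qed
        apply (rule order_trans[OF _ sums_time_mono[OF L_le]])
        using out(1) u_le by (simp add: sums_time_def circuit_size_def sz_def[symmetric])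
      done
    done
qed

lemma nonzero_fn:
  assumes "v = enc_vec s"
    "\<And>r T. r = enc_bool (\<exists>x\<in>set s. x \<noteq> 0) \<Longrightarrow> T \<le> 20 * (length s + 1) \<Longrightarrow> Q r T"
  shows "wp_fn (e # library) nonzero_fn [v] Q"
  using assms
proof (induction s arbitrary: v Q)
  case Nil
  then show ?case by (simp add: wp_fn_library nonzero_code_def)
next
  case (Cons x s)
  note prems = Cons.prems
  show ?case
  proof (cases "x = 0")
    case True
    show ?thesis
      apply (subst wp_fn_library)
      apply (simp add: nonzero_code_def prems(1) True)
      apply (rule Cons.IH; (simp only: )?)
      using prems(2) True by simp
  next
    case False
    show ?thesis
      apply (subst wp_fn_library)
      using prems(2) False by (simp add: nonzero_code_def prems(1))
  qed
qed

definition live_time :: "nat \<Rightarrow> nat \<Rightarrow> nat \<Rightarrow> nat \<Rightarrow> nat" where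
  "live_time K n sz M = (sums_time K n sz + 20 * (K + 1) + 60) * (M + 1)"

text \<open>The counter M is itself the parameter of the automaton, so counting down tries the
  moduli \<open>Suc M\<close>, ..., 1. The bound K covers the largest automaton.\<close>

lemma live_fn:
  assumes "v = enc_nat M" "w = enc_circuit C" "z = enc_word u" "z' = enc_nat n"
    "wf_circuit n C" "length u + Suc M \<le> K"
    "\<And>r T. r = enc_bool (\<exists>m\<le>M. \<exists>a\<le>m.
        path_sum (prefix_hash n u m) (circuit_poly C) 0 (length u + a) \<noteq> 0) \<Longrightarrow>
      T \<le> live_time K n (circuit_size C) M \<Longrightarrow> Q r T"
  shows "wp_fn (e # library) live_fn [v, w, z, z'] Q"
  using assms
proof (induction M arbitrary: v w z z' Q)
  case 0
  note prems = 0
  show ?case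
    apply (subst wp_fn_library)
    apply (simp add: live_code_def prems(1-4))
    apply (rule sums_fn[where m = 0 and K = K, OF refl refl _ refl prems(5)]; (simp; fail)?)
    subgoal using prems(6) by simp
    subgoal premises p for r T s
    proof -
      have iff: "(\<exists>x\<in>set s. x \<noteq> 0) \<longleftrightarrow> path_sum (prefix_hash n u 0) (circuit_poly C) 0 (length u) \<noteq> 0"
        using p(2) p(3)[of 0] by (cases s) auto
      show ?thesis
        apply (simp add: p(1))
        apply (rule nonzero_fn[where s = s]; (simp; fail)?)
        apply (unfold iff)
        using p(2,4) prems(6)
        by (auto intro!: prems(7) simp: live_time_def)
    qed
    done
next
  case (Suc M)
  note prems = Suc.prems
  show ?case
    apply (subst wp_fn_library)
    apply (simp add: live_code_def prems(1-4))
    apply (rule sums_fn[where m = "Suc M" and K = K, OF refl refl _ refl prems(5) prems(6)]; (simp; fail)?)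
    subgoal premises p for r T s
    proof -
      have iff: "(\<exists>x\<in>set s. x \<noteq> 0) \<longleftrightarrow>
          (\<exists>a\<le>Suc M. path_sum (prefix_hash n u (Suc M)) (circuit_poly C) 0 (length u + a) \<noteq> 0)"
      proof -
        have "(\<exists>x\<in>set s. x \<noteq> 0) \<longleftrightarrow> (\<exists>a\<le>Suc M. vnth s a \<noteq> 0)"
          using p(2) by (fastforce simp: vnth_def in_set_conv_nth Bex_def split: if_splits)
        then show ?thesis using p(3) by auto
      qed
      show ?thesis
        apply (simp add: p(1))
        apply (rule nonzero_fn[where s = s]; (simp; fail)?)
        apply (unfold iff)
        apply (cases "\<exists>a\<le>Suc M. path_sum (prefix_hash n u (Suc M)) (circuit_poly C) 0 (length u + a) \<noteq> 0")
        subgoal for r' T'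
          apply simp
          apply (rule prems(7))
          using p(2,4) prems(6) by (auto simp: live_time_def)
        subgoal premises q for r' T'
          apply (simp only: q if_False)
          apply simp
          apply (rule Suc.IH[OF refl refl refl refl prems(5)])
          subgoal using prems(6) by simp
          subgoal for r'' T''
            apply (rule prems(7))
            subgoal using q(3) by (auto simp: le_Suc_eq)
            using q(2) p(2,4) prems(6) by (simp add: live_time_def algebra_simps)
          done
        done
    qed
    done
qed

lemma prefix_fn:
  fixes C :: "'a::field circuit"
  assumes "v = enc_circuit C" "w = enc_word u" "z = enc_nat n"
    "wf_circuit n C" "length u + 1 \<le> K"
    "\<And>r T. r = Scalar (prefix_sum (circuit_poly C) u) \<Longrightarrow>
      T \<le> sums_time K n (circuit_size C) + 30 \<Longrightarrow> Q r T"
  shows "wp_fn (e # library) prefix_fn [v, w, z] Q"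
  apply (subst wp_fn_library)
  apply (simp add: prefix_code_def assms(1-3))
  apply (rule sums_fn[where m = 0 and K = K, OF refl refl _ refl assms(4)]; (simp; fail)?)
  subgoal using assms(5) by (simp add: One_nat_def)
  subgoal premises p for r T s
  proof -
    \<comment> \<open>An empty vector stands for the sum 0, which \<open>prefix_code\<close> returns
      in that case.\<close>
    have "vnth s 0 = prefix_sum (circuit_poly C) u"
      using p(3)[of 0] by (simp add: path_sum_prefix_sum)
    then show ?thesis using p(4) by (cases s) (auto simp: p(1) intro!: assms(6))
  qed
  done

definition coeff_time :: "nat \<Rightarrow> nat \<Rightarrow> nat \<Rightarrow> nat \<Rightarrow> nat" where
  "coeff_time K n sz x = (sums_time K n sz + 20 * K + 80) * (x + 1)"

lemma coeff_fn:
  fixes C :: "'a::field circuit"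
  assumes "v = enc_nat x" "w = Scalar c" "z = enc_circuit C" "z' = enc_word u" "z'' = enc_nat n"
    "wf_circuit n C" "length u + 2 \<le> K"
    "\<And>r T. r = Scalar (c - (\<Sum>y<x. prefix_sum (circuit_poly C) (u @ [y]))) \<Longrightarrow>
      T \<le> coeff_time K n (circuit_size C) x \<Longrightarrow> Q r T"
  shows "wp_fn (e # library) coeff_fn [v, w, z, z', z''] Q"
  using assms
proof (induction x arbitrary: v w z z' z'' c Q)
  case 0
  then show ?case by (simp add: wp_fn_library coeff_code_def coeff_time_def)
next
  case (Suc x)
  note prems = Suc.prems
  show ?case
    apply (subst wp_fn_library)
    apply (simp add: coeff_code_def prems(1-5))
    apply (rule append_fn[where xs = "map enc_nat u" and ys = "[enc_nat x]"]; (simp; fail)?)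
    apply simp
    apply (rule prefix_fn[where u = "u @ [x]" and K = K, OF refl _ refl prems(6)]; (simp; fail)?)
    subgoal using prems(7) by simp
    apply simp
    apply (rule Suc.IH[OF refl refl refl refl refl prems(6,7)])
    apply (rule prems(8))
     apply simp
    using prems(7) apply (simp add: coeff_time_def algebra_simps)
    done
qed

abbreviation enc_words :: "nat list list \<Rightarrow> 'a::field val" where
  "enc_words U \<equiv> enc_list (map (\<lambda>u. enc_list (map enc_nat u)) U)"

text \<open>K must allow for a child: \<open>length u + 1\<close> prefix states and
  \<open>Suc M\<close> residues.\<close>

lemma children_fn:
  fixes C :: "'a::field circuit"
  assumes "v = enc_nat x" "w = enc_word u" "z = enc_words W" "z1 = enc_circuit C" "z2 = enc_nat n"
    "z3 = enc_nat M" "wf_circuit n C" "length u + Suc (Suc M) \<le> K"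
    "\<And>u. live (circuit_poly C) u \<longleftrightarrow> (\<exists>m\<le>M. \<exists>a\<le>m.
        path_sum (prefix_hash n u m) (circuit_poly C) 0 (length u + a) \<noteq> 0)"
    "\<And>r T. r = enc_words (filter (live (circuit_poly C)) (map (\<lambda>y. u @ [y]) [0..<x]) @ W) \<Longrightarrow>
      T \<le> (live_time K n (circuit_size C) M + 20 * K + 60) * (x + 1) \<Longrightarrow> Q r T"
  shows "wp_fn (e # library) children_fn [v, w, z, z1, z2, z3] Q"
  using assms
proof (induction x arbitrary: v w z z1 z2 z3 W Q)
  case 0
  then show ?case by (simp add: wp_fn_library children_code_def)
next
  case (Suc x)
  note prems = Suc.prems
  show ?case
    apply (subst wp_fn_library)
    apply (simp add: children_code_def prems(1-6))
    apply (rule append_fn[where xs = "map enc_nat u" and ys = "[enc_nat x]"]; (simp; fail)?)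
    apply simp
    apply (rule live_fn[where u = "u @ [x]" and K = K, OF refl refl _ refl prems(7)]; (simp; fail)?)
    subgoal using prems(8) by simp
    apply (unfold prems(9)[symmetric])
    apply (cases "live (circuit_poly C) (u @ [x])")
    subgoal
      apply simp
      apply (rule Suc.IH[where W = "(u @ [x]) # W", OF refl refl _ refl refl refl prems(7-9)]; (simp; fail)?)
      apply (rule prems(10))
       apply simp
      using prems(8) by (simp add: algebra_simps)
    subgoal
      apply simp
      apply (rule Suc.IH[where W = W, OF refl refl _ refl refl refl prems(7-9)]; (simp; fail)?)
      apply (rule prems(10))
       apply simp
      using prems(8) by (simp add: algebra_simps)
    done
qed

text \<open>One step of the breadth-first search through the tree of prefixes of monomials.\<close>

definition extend :: "nat \<Rightarrow> 'a::field ncpoly \<Rightarrow> nat list list \<Rightarrow> nat list list" where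
  "extend n f U = concat (map (\<lambda>u. filter (live f) (map (\<lambda>y. u @ [y]) [0..<n])) U)"

definition level_time :: "nat \<Rightarrow> nat \<Rightarrow> nat \<Rightarrow> nat \<Rightarrow> nat \<Rightarrow> nat" where
  "level_time K n sz M l = ((live_time K n sz M + 20 * K + 60) * (n + 1) + 40) * (l + 1)"

lemma level_fn:
  fixes C :: "'a::field circuit"
  assumes "v = enc_words U" "w = enc_circuit C" "z = enc_nat n" "z' = enc_nat M"
    "wf_circuit n C" "\<forall>u\<in>set U. length u + Suc (Suc M) \<le> K"
    "\<And>u. live (circuit_poly C) u \<longleftrightarrow> (\<exists>m\<le>M. \<exists>a\<le>m.
        path_sum (prefix_hash n u m) (circuit_poly C) 0 (length u + a) \<noteq> 0)"
    "\<And>r T. r = enc_words (extend n (circuit_poly C) U) \<Longrightarrow>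
      T \<le> level_time K n (circuit_size C) M (length U) \<Longrightarrow> Q r T"
  shows "wp_fn (e # library) level_fn [v, w, z, z'] Q"
  using assms
proof (induction U arbitrary: v w z z' Q)
  case Nil
  then show ?case by (simp add: wp_fn_library level_code_def extend_def level_time_def)
next
  case (Cons u U)
  note prems = Cons.prems
  have u: "length u + Suc (Suc M) \<le> K" and U: "\<forall>u\<in>set U. length u + Suc (Suc M) \<le> K"
    using prems(6) by auto
  show ?case
    apply (subst wp_fn_library)
    apply (simp add: level_code_def prems(1-4))
    apply (rule Cons.IH[OF refl refl refl refl prems(5) U prems(7)])
    apply simp
    apply (rule children_fn[where u = u and W = "extend n (circuit_poly C) U",
          OF refl refl _ refl refl refl prems(5) u prems(7)]; (simp; fail)?)
    apply (rule prems(8))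
     apply (simp add: extend_def)
    apply (simp add: level_time_def algebra_simps)
    done
qed

text \<open>A live word is only a prefix of some monomial and may itself have coefficient 0, hence
  the filter.\<close>

definition terms_of :: "'a::field ncpoly \<Rightarrow> nat list list \<Rightarrow> (word \<times> 'a) list" where
  "terms_of f U = filter (\<lambda>m. snd m \<noteq> 0) (map (\<lambda>u. (Word u, nc_coeff f (Word u))) U)"

definition terms_time :: "nat \<Rightarrow> nat \<Rightarrow> nat \<Rightarrow> nat \<Rightarrow> nat" where
  "terms_time K n sz l = (coeff_time K n sz n + sums_time K n sz + 100) * (l + 1)"

lemma terms_fn:
  fixes C :: "'a::field circuit"
  assumes "v = enc_words U" "w = enc_list (map enc_term ms)" "z = enc_circuit C" "z' = enc_nat n"
    "wf_circuit n C" "\<forall>u\<in>set U. length u + 2 \<le> K"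
    "\<And>r T. r = enc_list (map enc_term (terms_of (circuit_poly C) U @ ms)) \<Longrightarrow>
      T \<le> terms_time K n (circuit_size C) (length U) \<Longrightarrow> Q r T"
  shows "wp_fn (e # library) terms_fn [v, w, z, z'] Q"
  using assms
proof (induction U arbitrary: v w z z' Q)
  case Nil
  then show ?case by (simp add: wp_fn_library terms_code_def terms_of_def terms_time_def)
next
  case (Cons u U)
  note prems = Cons.prems
  have u: "length u + 2 \<le> K" and U: "\<forall>u\<in>set U. length u + 2 \<le> K"
    using prems(6) by auto
  have c: "prefix_sum (circuit_poly C) u - (\<Sum>x<n. prefix_sum (circuit_poly C) (u @ [x]))
      = nc_coeff (circuit_poly C) (Word u)"
    using nc_coeff_prefix_sum[of "circuit_poly C" n u] poly_letters_circuit_poly[OF prems(5)]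
    by (simp add: poly_letters_def)
  have enc: "enc_term (Word u, x) = Pair (enc_word u) (Scalar x)" for x :: 'a
    by (simp add: enc_term_def)
  show ?case
    apply (subst wp_fn_library)
    apply (simp add: terms_code_def prems(1-4))
    apply (rule prefix_fn[where u = u and K = K, OF refl refl refl prems(5)]; (simp; fail)?)
    subgoal using u by simp
    apply simp
    apply (rule coeff_fn[where u = u, OF refl refl refl refl refl prems(5) u])
    apply (unfold c)
    apply simp
    apply (rule Cons.IH[OF refl refl refl refl prems(5) U])
    apply (cases "nc_coeff (circuit_poly C) (Word u) = 0")
    subgoal
      apply simp
      apply (rule prems(7))
       apply (simp add: terms_of_def)
      by (simp add: terms_time_def algebra_simps)
    subgoal
      apply simp
      apply (rule prems(7))
       apply (simp add: terms_of_def enc)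
      by (simp add: terms_time_def algebra_simps)
    done
qed

section \<open>Correctness of the search, independently of the program\<close>

fun expand :: "nat \<Rightarrow> 'a::field ncpoly \<Rightarrow> nat \<Rightarrow> nat list list \<Rightarrow> (word \<times> 'a) list" where
  "expand n f 0 U = terms_of f U"
| "expand n f (Suc d) U = terms_of f U @ expand n f d (extend n f U)"

lemma set_extend: "set (extend n f U) = {u @ [y] | u y. u \<in> set U \<and> y < n \<and> live f (u @ [y])}"
  by (auto simp: extend_def)

lemma distinct_extend:
  assumes "distinct U"
  shows "distinct (extend n f U)"
  using assms
proof (induction U)
  case (Cons u U)
  then have "distinct (extend n f U)" "u \<notin> set U" by auto
  moreover have "extend n f (u # U) = filter (live f) (map (\<lambda>y. u @ [y]) [0..<n]) @ extend n f U"
    by (simp add: extend_def)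
  moreover have "distinct (filter (live f) (map (\<lambda>y. u @ [y]) [0..<n]))"
    by (intro distinct_filter) (auto simp: distinct_map intro: inj_onI)
  ultimately show ?case by (auto simp: set_extend)
qed (simp add: extend_def)

lemma length_extend:
  assumes "distinct U" "\<forall>u\<in>set U. length u = k"
  shows "length (extend n f U) \<le> card (nc_monomials f)"
proof -
  have "length (extend n f U) = card (set (extend n f U))"
    by (simp add: distinct_card distinct_extend assms(1))
  also have "\<dots> \<le> card {u. length u = Suc k \<and> live f u}"
    using assms(2) by (intro card_mono finite_live) (auto simp: set_extend)
  also have "\<dots> \<le> card (nc_monomials f)" by (rule card_live)
  finally show ?thesis .
qed

text \<open>A monomial with a prefix in U either lies in U or passes through a one-letter extension,
  which is live because of this very monomial; so pruning dead extensions loses nothing.\<close>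

lemma set_expand:
  assumes "poly_letters n f"
  shows "set (expand n f d U) = (\<lambda>w. (w, nc_coeff f w)) `
    {w \<in> nc_monomials f. \<exists>u\<in>set U. \<exists>v. letters w = u @ v \<and> length v \<le> d}"
proof (induction d arbitrary: U)
  case 0
  show ?case by (auto simp: terms_of_def in_keys_iff image_iff) (metis word.collapse)+
next
  case (Suc d)
  have iff: "(\<exists>u\<in>set U. \<exists>v. letters w = u @ v \<and> length v \<le> Suc d) \<longleftrightarrow>
     letters w \<in> set U \<or> (\<exists>u\<in>set (extend n f U). \<exists>v. letters w = u @ v \<and> length v \<le> d)"
    if w: "w \<in> nc_monomials f" for w
  proof
    assume "\<exists>u\<in>set U. \<exists>v. letters w = u @ v \<and> length v \<le> Suc d"
    then obtain u v where uv: "u \<in> set U" "letters w = u @ v" "length v \<le> Suc d" by blast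
    show "letters w \<in> set U \<or> (\<exists>u\<in>set (extend n f U). \<exists>v. letters w = u @ v \<and> length v \<le> d)"
    proof (cases v)
      case (Cons y v')
      have "y < n" using assms w uv Cons by (auto simp: poly_letters_def)
      moreover have "live f (u @ [y])" unfolding live_def using w uv Cons
        by (intro exI[of _ v']) (metis append.assoc append_Cons append_Nil word.collapse)
      ultimately have "u @ [y] \<in> set (extend n f U)" using uv by (auto simp: set_extend)
      then show ?thesis using uv Cons by force
    qed (use uv in auto)
  next
    assume "letters w \<in> set U \<or> (\<exists>u\<in>set (extend n f U). \<exists>v. letters w = u @ v \<and> length v \<le> d)"
    then show "\<exists>u\<in>set U. \<exists>v. letters w = u @ v \<and> length v \<le> Suc d"
    proof
      assume "letters w \<in> set U"
      then show ?thesis by (intro bexI[of _ "letters w"] exI[of _ "[]"]) auto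
    next
      assume "\<exists>u\<in>set (extend n f U). \<exists>v. letters w = u @ v \<and> length v \<le> d"
      then obtain u y v where "u \<in> set U" "letters w = u @ y # v" "length v \<le> d"
        by (auto simp: set_extend)
      then show ?thesis by (intro bexI[of _ u] exI[of _ "y # v"]) auto
    qed
  qed
  have "{w \<in> nc_monomials f. \<exists>u\<in>set U. \<exists>v. letters w = u @ v \<and> length v \<le> Suc d} =
    {w \<in> nc_monomials f. letters w \<in> set U} \<union>
    {w \<in> nc_monomials f. \<exists>u\<in>set (extend n f U). \<exists>v. letters w = u @ v \<and> length v \<le> d}"
    using iff by blast
  moreover have "set (terms_of f U) = (\<lambda>w. (w, nc_coeff f w)) ` {w \<in> nc_monomials f. letters w \<in> set U}"
    by (auto simp: terms_of_def in_keys_iff image_iff) (metis word.collapse)+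
  ultimately show ?case by (simp only: expand.simps set_append Suc.IH image_Un)
qed

lemma distinct_terms_of: "distinct U \<Longrightarrow> distinct (terms_of f U)"
  unfolding terms_of_def by (intro distinct_filter) (auto simp: distinct_map intro: inj_onI)

text \<open>A level contains words of one length and deeper levels only longer ones, so no word is
  reported twice.\<close>

lemma distinct_expand:
  assumes "poly_letters n f" "distinct U" "\<forall>u\<in>set U. length u = k"
  shows "distinct (expand n f d U)"
  using assms(2,3)
proof (induction d arbitrary: U k)
  case 0
  then show ?case by (simp add: distinct_terms_of)
next
  case (Suc d)
  have "\<forall>u\<in>set (extend n f U). length u = Suc k" using Suc.prems by (auto simp: set_extend)
  then have "distinct (expand n f d (extend n f U))"
    using Suc.IH distinct_extend[OF Suc.prems(1)] by blast
  moreover have "length (letters (fst m)) = k" if "m \<in> set (terms_of f U)" for m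
    using that Suc.prems by (auto simp: terms_of_def)
  moreover have "length (letters (fst m)) > k" if "m \<in> set (expand n f d (extend n f U))" for m
    using that Suc.prems by (auto simp: set_expand[OF assms(1)] set_extend)
  ultimately have "set (terms_of f U) \<inter> set (expand n f d (extend n f U)) = {}"
    "distinct (expand n f d (extend n f U))" by (blast, fastforce)
  then show ?case using distinct_terms_of Suc.prems by simp
qed

lemma is_expansion_expand:
  assumes "poly_letters n f" "nc_degree f \<le> d"
  shows "is_expansion f (expand n f d [[]])"
proof -
  have "length (letters w) \<le> d" if "w \<in> nc_monomials f" for w
    using length_le_nc_degree[OF that] assms(2) by simp
  then show ?thesis unfolding is_expansion_def
    using distinct_expand[OF assms(1), of "[[]]" 0 d] by (auto simp: set_expand[OF assms(1)])
qed

text \<open>\<open>Suc t\<close> allows for the root level: the empty word is entered untested, so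
  it is present even for t = 0. Every later level has at most t words. Since k + d stays constant,
  one K serves the whole recursion.\<close>

lemma search_fn:
  fixes C :: "'a::field circuit"
  assumes "v = enc_nat d" "w = enc_words U" "z = enc_circuit C" "z' = enc_nat n" "z'' = enc_nat M"
    "wf_circuit n C" "k + d + M + 2 \<le> K" "\<forall>u\<in>set U. length u = k" "distinct U"
    "length U \<le> Suc t" "card (nc_monomials (circuit_poly C)) \<le> t"
    "\<And>u. live (circuit_poly C) u \<longleftrightarrow> (\<exists>m\<le>M. \<exists>a\<le>m.
        path_sum (prefix_hash n u m) (circuit_poly C) 0 (length u + a) \<noteq> 0)"
    "\<And>r T. r = enc_list (map enc_term (expand n (circuit_poly C) d U)) \<Longrightarrow>
      T \<le> (level_time K n (circuit_size C) M (Suc t) + terms_time K n (circuit_size C) (Suc t) + 60)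
        * (d + 1) \<Longrightarrow> Q r T"
  shows "wp_fn (e # library) search_fn [v, w, z, z', z''] Q"
  using assms
proof (induction d arbitrary: v w z z' z'' U k Q)
  case 0
  note prems = 0
  have U: "\<forall>u\<in>set U. length u + 2 \<le> K" using prems(7,8) by auto
  have "terms_time K n (circuit_size C) (length U) \<le> terms_time K n (circuit_size C) (Suc t)"
    unfolding terms_time_def using prems(10) by (intro mult_le_mono2) simp
  note le = order_trans[OF _ this]
  show ?case
    apply (subst wp_fn_library)
    apply (simp add: search_code_def prems(1-5))
    apply (rule terms_fn[where ms = "[]", OF refl _ refl refl prems(6) U]; (simp; fail)?)
    apply (drule le)
    apply (rule prems(13))
     apply simp
    apply simp
    done
next
  case (Suc d)
  note prems = Suc.prems
  have U: "\<forall>u\<in>set U. length u + 2 \<le> K" and U': "\<forall>u\<in>set U. length u + Suc (Suc M) \<le> K"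
    using prems(7,8) by auto
  have "terms_time K n (circuit_size C) (length U) \<le> terms_time K n (circuit_size C) (Suc t)"
    unfolding terms_time_def using prems(10) by (intro mult_le_mono2) simp
  note le = order_trans[OF _ this]
  have "level_time K n (circuit_size C) M (length U) \<le> level_time K n (circuit_size C) M (Suc t)"
    unfolding level_time_def using prems(10) by (intro mult_le_mono2) simp
  note le' = order_trans[OF _ this]
  have K: "Suc k + d + M + 2 \<le> K" using prems(7) by simp
  have E: "\<forall>u\<in>set (extend n (circuit_poly C) U). length u = Suc k"
    using prems(8) by (auto simp: set_extend)
  have L: "length (extend n (circuit_poly C) U) \<le> Suc t"
    using length_extend[OF prems(9,8), of n "circuit_poly C"] prems(11) by simp
  show ?case
    apply (subst wp_fn_library)
    apply (simp add: search_code_def prems(1-5))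
    apply (rule level_fn[OF refl refl refl refl prems(6) U' prems(12)])
    apply (drule le')
    apply simp
    apply (rule Suc.IH[OF refl refl refl refl refl prems(6) K E distinct_extend[OF prems(9)] L prems(11,12)])
    apply simp
    apply (rule terms_fn[OF refl refl refl refl prems(6) U])
    apply (drule le)
    apply (rule prems(13))
     apply simp
    apply (simp add: algebra_simps)
    done
qed

text \<open>Half of the limit for the moduli in \<open>live_iff_path_sum\<close>.\<close>

definition hash_bound :: "nat \<Rightarrow> nat \<Rightarrow> nat \<Rightarrow> nat" where
  "hash_bound n d t = Suc t * (Suc n * Suc d)"

definition solve_time :: "nat \<Rightarrow> nat \<Rightarrow> nat \<Rightarrow> nat \<Rightarrow> nat" where
  "solve_time n d t sz =
    (level_time (d + 2 * hash_bound n d t + 2) n sz (2 * hash_bound n d t) (Suc t)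
      + terms_time (d + 2 * hash_bound n d t + 2) n sz (Suc t) + 60) * (d + 1)
    + (20 * (d + 1) + 40) * (n + 2) + (20 * (Suc n * Suc d) + 40) * (t + 2)
    + 20 * (hash_bound n d t + 1) + 60"

lemma solve_fn:
  fixes C :: "'a::field circuit"
  assumes "v = enc_circuit C" "w = enc_nat n" "z = enc_nat d" "z' = enc_nat t"
    and wf: "wf_circuit n C" and deg: "nc_degree (circuit_poly C) \<le> d"
    and card: "card (nc_monomials (circuit_poly C)) \<le> t"
    and Q: "\<And>r T ms. r = enc_list (map enc_term ms) \<Longrightarrow> is_expansion (circuit_poly C) ms \<Longrightarrow>
      T \<le> solve_time n d t (circuit_size C) \<Longrightarrow> Q r T"
  shows "wp_fn (e # library) solve_fn [v, w, z, z'] Q"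
proof -
  define H where "H = hash_bound n d t"
  have pl: "poly_letters n (circuit_poly C)" using wf by (rule poly_letters_circuit_poly)
  have words: "set (letters w) \<subseteq> {..<n} \<and> length (letters w) \<le> d"
    if "w \<in> nc_monomials (circuit_poly C)" for w
    using pl that length_le_nc_degree[OF that] deg by (auto simp: poly_letters_def)
  have live: "live (circuit_poly C) u \<longleftrightarrow> (\<exists>m\<le>2 * H. \<exists>a\<le>m.
        path_sum (prefix_hash n u m) (circuit_poly C) 0 (length u + a) \<noteq> 0)" for u
    by (rule live_iff_path_sum[OF words card]) (simp_all add: H_def hash_bound_def)
  show ?thesis
    apply (subst wp_fn_library)
    apply (simp add: solve_code_def assms(1-4))
    apply (rule mult_fn[where xs = "replicate (Suc n) Empty" and b = "Suc d"]; (simp add: enc_nat_conv_list; fail)?)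
    apply simp
    apply (rule mult_fn[where xs = "replicate (Suc t) Empty" and b = "Suc n * Suc d"];
        (simp add: enc_nat_conv_list; fail)?)
    apply simp
    apply (rule append_fn[where xs = "replicate H Empty" and ys = "replicate H Empty"])
      apply (simp add: H_def hash_bound_def enc_nat_conv_list)
     apply (simp add: H_def hash_bound_def enc_nat_conv_list)
    apply simp
    apply (rule search_fn[where U = "[[]]" and k = 0 and K = "d + 2 * H + 2" and t = t and M = "2 * H",
          OF refl _ refl refl _ wf _ _ _ _ card live]; (simp; fail)?)
    subgoal by (simp add: enc_nat_conv_list mult_2 replicate_add)
    apply (rule Q[OF _ is_expansion_expand[OF pl deg]])
     apply assumption
    apply (simp add: solve_time_def H_def[symmetric] algebra_simps)
    done
qed

section \<open>Polynomial time bounds\<close>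

text \<open>One variable is enough: the time bounds are monotone, so every parameter can be raised
  to a common bound.\<close>

definition poly_bounded :: "(nat \<Rightarrow> nat) \<Rightarrow> bool" where
  "poly_bounded g \<longleftrightarrow> (\<exists>c k. \<forall>s. g s \<le> c * (s + 1) ^ k)"

lemma poly_bounded_id: "poly_bounded (\<lambda>s. s)"
  unfolding poly_bounded_def by (rule exI[of _ 1], rule exI[of _ 1]) auto

lemma poly_bounded_const: "poly_bounded (\<lambda>s. c)"
  unfolding poly_bounded_def by (rule exI[of _ c], rule exI[of _ 0]) auto

lemma poly_bounded_add:
  assumes "poly_bounded f" "poly_bounded g"
  shows "poly_bounded (\<lambda>s. f s + g s)"
proof -
  obtain c k c' k' where "\<forall>s. f s \<le> c * (s + 1) ^ k" "\<forall>s. g s \<le> c' * (s + 1) ^ k'"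
    using assms unfolding poly_bounded_def by blast
  moreover have "c * (s + 1) ^ k \<le> c * (s + 1) ^ (k + k')" "c' * (s + 1) ^ k' \<le> c' * (s + 1) ^ (k + k')" for s
    by (intro mult_le_mono2 power_increasing; simp)+
  ultimately have "f s + g s \<le> (c + c') * (s + 1) ^ (k + k')" for s
    unfolding add_mult_distrib by (meson add_mono order_trans)
  then show ?thesis unfolding poly_bounded_def by blast
qed

lemma poly_bounded_mult:
  assumes "poly_bounded f" "poly_bounded g"
  shows "poly_bounded (\<lambda>s. f s * g s)"
proof -
  obtain c k c' k' where "\<forall>s. f s \<le> c * (s + 1) ^ k" "\<forall>s. g s \<le> c' * (s + 1) ^ k'"
    using assms unfolding poly_bounded_def by blast
  then have "f s * g s \<le> (c * (s + 1) ^ k) * (c' * (s + 1) ^ k')" for s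
    by (intro mult_le_mono) auto
  moreover have "(c * (s + 1) ^ k) * (c' * (s + 1) ^ k') = (c * c') * (s + 1) ^ (k + k')" for s
    by (simp only: power_add ac_simps)
  ultimately have "f s * g s \<le> (c * c') * (s + 1) ^ (k + k')" for s
    by (simp only:)
  then show ?thesis unfolding poly_bounded_def by blast
qed

lemma poly_bounded_power: "poly_bounded f \<Longrightarrow> poly_bounded (\<lambda>s. f s ^ b)"
  by (induction b) (auto intro: poly_bounded_const poly_bounded_mult)

lemma poly_bounded_Suc: "poly_bounded f \<Longrightarrow> poly_bounded (\<lambda>s. Suc (f s))"
  using poly_bounded_add[OF _ poly_bounded_const[of 1]] by (simp add: One_nat_def)

lemmas poly_bounded_intros =
  poly_bounded_id poly_bounded_const poly_bounded_add poly_bounded_mult poly_bounded_power poly_bounded_Suc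

lemmas time_defs = solve_time_def hash_bound_def level_time_def terms_time_def coeff_time_def
  live_time_def sums_time_def gate_time_def

lemma solve_time_mono:
  "n \<le> n' \<Longrightarrow> d \<le> d' \<Longrightarrow> t \<le> t' \<Longrightarrow> sz \<le> sz' \<Longrightarrow> solve_time n d t sz \<le> solve_time n' d' t' sz'"
  unfolding time_defs by (intro add_mono mult_le_mono Suc_le_mono[THEN iffD2] order_refl)

lemma poly_bounded_solve_time:
  assumes "poly_bounded n" "poly_bounded d" "poly_bounded t" "poly_bounded sz"
  shows "poly_bounded (\<lambda>s. solve_time (n s) (d s) (t s) (sz s))"
  unfolding time_defs by (intro poly_bounded_intros assms)

section \<open>Computing the bounds on degree and sparsity from the input\<close>

definition base_expr :: expr where
  "base_expr = PairE EmptyE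
    (CallE append_fn [CallE mult_fn [FstE (Var 0), PairE EmptyE EmptyE], Var 1])"

lemma wp_base_expr:
  assumes "\<And>r T. r = enc_nat (circuit_size C + n + 1) \<Longrightarrow> T \<le> 100 * (circuit_size C + n + 2) \<Longrightarrow> Q r T"
  shows "wp (e # library) [enc_circuit C, enc_nat n] base_expr Q"
  apply (simp add: base_expr_def enc_circuit_def)
  \<comment> \<open>Multiplication by 1 replaces every gate by \<open>Empty\<close>, so the gate
    list becomes its length in unary.\<close>
  apply (rule mult_fn[where xs = "map enc_gate (gates C)" and b = 1]; (simp add: enc_nat_numerals; fail)?)
  apply simp
  apply (rule append_fn[where xs = "replicate (length (gates C)) Empty" and ys = "replicate n Empty"];
      (simp add: enc_nat_conv_list; fail)?)
  apply (rule assms)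
   apply (simp add: enc_nat_conv_list circuit_size_def replicate_add One_nat_def)
  apply (simp add: circuit_size_def)
  done

text \<open>The exponent is fixed before the program is chosen, so the power is written out as
  nested calls; \<open>const_expr\<close> does the same for the factor.\<close>

fun pow_expr :: "nat \<Rightarrow> expr" where
  "pow_expr 0 = PairE EmptyE EmptyE"
| "pow_expr (Suc b) = CallE mult_fn [base_expr, pow_expr b]"

fun pow_time :: "nat \<Rightarrow> nat \<Rightarrow> nat" where
  "pow_time 0 s = 3"
| "pow_time (Suc b) s = 100 * (s + 1) + pow_time b s + (20 * s ^ b + 40) * (s + 1) + 1"

lemma wp_pow_expr:
  assumes "s = circuit_size C + n + 1"
    "\<And>r T. r = enc_nat (s ^ b) \<Longrightarrow> T \<le> pow_time b s \<Longrightarrow> Q r T"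
  shows "wp (e # library) [enc_circuit C, enc_nat n] (pow_expr b) Q"
  using assms(2)
proof (induction b arbitrary: Q)
  case 0
  then show ?case by (simp add: enc_nat_numerals)
next
  case (Suc b)
  show ?case
    apply simp
    apply (rule wp_base_expr)
    apply simp
    apply (rule Suc.IH)
    apply simp
    apply (rule mult_fn[where xs = "replicate s Empty" and b = "s ^ b"])
      apply (simp add: enc_nat_conv_list assms(1))
     apply simp
    apply (rule Suc.prems)
     apply simp
    using assms(1) apply simp
    done
qed

fun const_expr :: "nat \<Rightarrow> expr" where
  "const_expr 0 = EmptyE"
| "const_expr (Suc a) = PairE EmptyE (const_expr a)"

lemma wp_const_expr:
  "Q (enc_nat a) (2 * a + 1) \<Longrightarrow> wp P env (const_expr a) Q"
  by (induction a arbitrary: Q) simp_all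

text \<open>One computed number is passed both as the degree bound and as the bound on the number of
  monomials.\<close>

definition bound_expr :: "nat \<Rightarrow> nat \<Rightarrow> expr" where
  "bound_expr a b = LetE (CallE mult_fn [const_expr a, pow_expr b])
    (CallE solve_fn [Var 1, Var 2, Var 0, Var 0])"

definition bound_time :: "nat \<Rightarrow> nat \<Rightarrow> nat \<Rightarrow> nat" where
  "bound_time a b s = 2 * a + pow_time b s + (20 * s ^ b + 40) * (a + 1)
    + solve_time s (a * s ^ b) (a * s ^ b) s + 20"

lemma poly_bounded_bound_time: "poly_bounded (bound_time a b)"
proof -
  have "poly_bounded (pow_time b)" 
    by (induction b) (auto intro!: poly_bounded_intros)
  then show ?thesis
    unfolding bound_time_def[abs_def] by (intro poly_bounded_intros poly_bounded_solve_time)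
qed

lemma reconstructs_within_wp:
  assumes "wp (e # library) args e (\<lambda>r T. \<exists>ms. is_expansion f ms \<and> r = enc_list (map enc_term ms) \<and> T \<le> B)"
  shows "reconstructs_within (e # library) args f B"
  using assms unfolding reconstructs_within_def wp_def runs_def by auto

lemma reconstructs_within_mono:
  "reconstructs_within P args f B \<Longrightarrow> B \<le> B' \<Longrightarrow> reconstructs_within P args f B'"
  unfolding reconstructs_within_def using order_trans by blast

definition solve_entry :: expr where
  "solve_entry = CallE solve_fn [Var 0, Var 1, Var 2, Var 3]"

text \<open>The 5 extra steps are the four arguments and the call itself.\<close>

lemma solve_entry_reconstructs:
  assumes "wf_circuit n C" "nc_degree (circuit_poly C) \<le> d" "card (nc_monomials (circuit_poly C)) \<le> t"
  shows "reconstructs_within (solve_entry # library) [enc_circuit C, enc_nat n, enc_nat d, enc_nat t]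
    (circuit_poly C) (solve_time n d t (circuit_size C) + 5)"
  apply (rule reconstructs_within_wp)
  apply (unfold solve_entry_def)
  apply simp
  apply (rule solve_fn[OF refl refl refl refl assms])
  apply auto
  done

lemma bound_expr_reconstructs:
  assumes "wf_circuit n C" "s = circuit_size C + n + 1"
    "nc_degree (circuit_poly C) \<le> a * s ^ b" "card (nc_monomials (circuit_poly C)) \<le> a * s ^ b"
  shows "reconstructs_within (bound_expr a b # library) [enc_circuit C, enc_nat n]
    (circuit_poly C) (bound_time a b s)"
proof -
  have "solve_time n (a * s ^ b) (a * s ^ b) (circuit_size C) \<le> solve_time s (a * s ^ b) (a * s ^ b) s"
    by (rule solve_time_mono) (use assms(2) in auto)
  note le = order_trans[OF _ this]
  show ?thesis
    apply (rule reconstructs_within_wp)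
    apply (subst (2) bound_expr_def)
    apply simp
    apply (rule wp_const_expr)
    apply simp
    apply (rule wp_pow_expr[OF assms(2)])
    apply simp
    apply (rule mult_fn[where xs = "replicate a Empty" and b = "s ^ b"])
      apply (simp add: enc_nat_conv_list)
     apply simp
    apply simp
    apply (rule solve_fn[OF refl refl refl refl assms(1,3,4)])
    apply (drule le)
    apply (auto simp: bound_time_def)
    done
qed

theorem theorem3:
  shows "(\<exists>(P :: prog) c k. \<forall>(C :: 'a::field circuit) n d t.
            wf_circuit n C \<longrightarrow>
            nc_degree (circuit_poly C) \<le> d \<longrightarrow>
            card (nc_monomials (circuit_poly C)) \<le> t \<longrightarrow>
            reconstructs_within P [enc_circuit C, enc_nat n, enc_nat d, enc_nat t]
              (circuit_poly C) (c * (circuit_size C + d + n + t + 1) ^ k))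
       \<and> (\<forall>a b. \<exists>(P :: prog) c k. \<forall>(C :: 'a::field circuit) n.
            wf_circuit n C \<longrightarrow>
            nc_degree (circuit_poly C) \<le> a * (circuit_size C + n + 1) ^ b \<longrightarrow>
            card (nc_monomials (circuit_poly C)) \<le> a * (circuit_size C + n + 1) ^ b \<longrightarrow>
            reconstructs_within P [enc_circuit C, enc_nat n]
              (circuit_poly C) (c * (circuit_size C + n + 1) ^ k))"
proof (intro conjI allI)
  have "poly_bounded (\<lambda>s. solve_time s s s s + 5)"
    by (intro poly_bounded_intros poly_bounded_solve_time)
  then obtain c k where ck: "\<And>s. solve_time s s s s + 5 \<le> c * (s + 1) ^ k"
    unfolding poly_bounded_def by blast
  show "\<exists>(P :: prog) c k. \<forall>(C :: 'a circuit) n d t.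
            wf_circuit n C \<longrightarrow>
            nc_degree (circuit_poly C) \<le> d \<longrightarrow>
            card (nc_monomials (circuit_poly C)) \<le> t \<longrightarrow>
            reconstructs_within P [enc_circuit C, enc_nat n, enc_nat d, enc_nat t]
              (circuit_poly C) (c * (circuit_size C + d + n + t + 1) ^ k)"
  proof (intro exI allI impI)
    fix C :: "'a circuit" and n d t
    assume *: "wf_circuit n C" "nc_degree (circuit_poly C) \<le> d" "card (nc_monomials (circuit_poly C)) \<le> t"
    let ?s = "circuit_size C + d + n + t"
    \<comment> \<open>All four parameters are raised to their sum, which leaves a bound in one
      variable.\<close>
    have "solve_time n d t (circuit_size C) + 5 \<le> solve_time ?s ?s ?s ?s + 5"
      by (intro add_right_mono solve_time_mono) auto
    also note ck
    finally show "reconstructs_within (solve_entry # library)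
        [enc_circuit C, enc_nat n, enc_nat d, enc_nat t] (circuit_poly C) (c * (?s + 1) ^ k)"
      by (rule reconstructs_within_mono[OF solve_entry_reconstructs[OF *]])
  qed
next
  fix a b
  obtain c k where ck: "\<And>s. bound_time a b s \<le> c * (s + 1) ^ k"
    using poly_bounded_bound_time unfolding poly_bounded_def by blast
  show "\<exists>(P :: prog) c k. \<forall>(C :: 'a circuit) n.
            wf_circuit n C \<longrightarrow>
            nc_degree (circuit_poly C) \<le> a * (circuit_size C + n + 1) ^ b \<longrightarrow>
            card (nc_monomials (circuit_poly C)) \<le> a * (circuit_size C + n + 1) ^ b \<longrightarrow>
            reconstructs_within P [enc_circuit C, enc_nat n]
              (circuit_poly C) (c * (circuit_size C + n + 1) ^ k)"
  proof (intro exI allI impI)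
    fix C :: "'a circuit" and n
    let ?s = "circuit_size C + n + 1"
    assume *: "wf_circuit n C" "nc_degree (circuit_poly C) \<le> a * ?s ^ b"
      "card (nc_monomials (circuit_poly C)) \<le> a * ?s ^ b"
    have "bound_time a b ?s \<le> c * (?s + 1) ^ k" by (rule ck)
    \<comment> \<open>Here \<open>?s\<close> is at least 1, so the extra 1 from
      \<open>poly_bounded\<close> is absorbed by a factor 2.\<close>
    also have "\<dots> \<le> c * (2 * ?s) ^ k" by (intro mult_le_mono2 power_mono) auto
    also have "\<dots> = (c * 2 ^ k) * ?s ^ k" by (simp only: power_mult_distrib mult.assoc)
    finally show "reconstructs_within (bound_expr a b # library) [enc_circuit C, enc_nat n]
        (circuit_poly C) ((c * 2 ^ k) * ?s ^ k)"
      by (rule reconstructs_within_mono[OF bound_expr_reconstructs[OF *(1) refl *(2,3)]])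
  qed
qed

end
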